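(* Let $\Omega\subset\mathbb R^n$ ($n\ge 2$) be a domain, let $s\ge 2$, let $f\in C^s(\Omega,\mathbb R)$ be such that $\nabla f(x)\neq 0$ at every point of $\Gamma=\{x\in\Omega: f(x)=0\}$, let $\vec V\in C^s(\Omega,\mathbb R^n)$, let $r>0$ be real, and let $\vec W=f^{-r}\vec V$ on $\Omega\setminus\Gamma$. Let $\varphi\in C^s(\Omega)$ be real-valued with $\varphi(x)\neq 0$ for every $x\in\Omega$. Consider the conditions (a) $\lim_{x\to x_*} f^{r+1}(x)D_{\vec W}(x)=0$ for all $x_*\in\Gamma$; (b) $\lim_{x\to x_*} f^r(x)D_{\vec W}(x)=0$ and $\lim_{x\to x_*} f^{r+1}(x)\frac{\partial D_{\vec W}}{\partial x_i}(x)=0$ for every $x_*\in\Gamma$ with $\vec V(x_* )=0$ and every $i=1,\dots,n$. Then the following hold for the fields $\varphi\vec V$ and $\varphi\vec W=f^{-r}(\varphi\vec V)$. (1) Condition (a) holds if and only if $\Gamma$ is an invariant hypersurface of $\varphi\vec V$. The function $f$ is a first integral of $\varphi\vec V$ if and only if $f^rD_{\varphi\vec W}\equiv D_{\varphi\vec V}$. If $f$ is a first integral of $\varphi\vec V$ and (b) holds, then $D_{\varphi\vec V}(x_* )=0$ for every $x_*\in\Gamma$ with $\vec V(x_* )=0$. (2) Let $x_*\in\Gamma$ be a singular point of $\varphi\vec V$ and let $\lambda_1,\dots,\lambda_n$ be the eigenvalues of the linearization of $\varphi\vec V$ at $x_*$. If (a) and (b) hold, then there exists $j\in\{1,\dots,n\}$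 such that $\lambda_1+\cdots+\lambda_n=r\lambda_j$; there exists an eigenvector corresponding to $\lambda_j$ which is transversal to $\Gamma$ at $x_*$; the spectrum of the linearization of the restriction $\varphi\vec V|_\Gamma$ at $x_*$ is $\{\lambda_1,\dots,\lambda_n\}\setminus\lambda_j$; and if $f$ is a first integral of $\varphi\vec V$, then $\lambda_j=0$.
   Context: $D_{\vec X}$ denotes the divergence of a vector field $\vec X$ in the Cartesian coordinates $x_1,\dots,x_n$; $L_{\vec X}$ is the Lie derivative. $D_{\vec W}$ and $D_{\varphi\vec W}$ are defined on $\Omega\setminus\Gamma$; limits as $x\to x_*\in\Gamma$ are over $x\in\Omega\setminus\Gamma$, and the identity $f^rD_{\varphi\vec W}\equiv D_{\varphi\vec V}$ is understood on $\Omega\setminus\Gamma$ (with the left side extended to $\Gamma$ by continuity). $\Gamma$ is an invariant hypersurface of a field $\vec X$ if $L_{\vec X}f|_\Gamma=0$; $f$ is a first integral of $\vec X$ if $L_{\vec X}f\equiv0$ on $\Omega$. A singular point is a zero of the field; the linearization there is the Jacobian matrix. Eigenvalues are counted with multiplicity and $\{\lambda_1,\dots,\lambda_n\}\setminus\lambda_j$ means the multiset with the single entry $\lambda_j$ removed. For non-integer $r$, real powers of $f$ on $\{f<0\}$ are understood via one fixed continuous branch $f^a=e^{a\log f}$ (possibly complex-valued), so that $f^{a+b}=f^af^b$ and $\partial_{x_i}f^a=af^{a-1}\partial_{x_i}f$.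
   Formalization: The transversal eigenvector for λ_j can fail to exist when λ_j is defective (f=x_1, V=(0,x_1), φ=1); what is proved is a transversal generalized eigenvector always, and a transversal eigenvector when λ_j is a simple eigenvalue. *)

theory Defs
  imports "HOL-Analysis.Analysis" "HOL-Computational_Algebra.Polynomial"
begin

definition partial_deriv :: "'n::finite \<Rightarrow> (real^'n \<Rightarrow> 'b::real_normed_vector) \<Rightarrow> real^'n \<Rightarrow> 'b" where
  "partial_deriv i g x = vector_derivative (\<lambda>t. g (x + t *\<^sub>R axis i 1)) (at 0)"

text \<open>The class \<open>C\<^sup>k\<close> on an open set.\<close>

primrec C_k_on :: "nat \<Rightarrow> (real^'n::finite \<Rightarrow> 'b::real_normed_vector) \<Rightarrow> (real^'n) set \<Rightarrow> bool" where
  "C_k_on 0 g S \<longleftrightarrow> continuous_on S g"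
| "C_k_on (Suc k) g S \<longleftrightarrow> g differentiable_on S \<and> (\<forall>i. C_k_on k (partial_deriv i g) S)"

definition gradient :: "(real^'n::finite \<Rightarrow> real) \<Rightarrow> real^'n \<Rightarrow> real^'n" where
  "gradient f x = (\<chi> i. partial_deriv i f x)"

text \<open>The divergence is polymorphic because \<open>f\<^sup>-\<^sup>r V\<close> may be complex where \<open>f\<close> is negative.\<close>

definition divergence :: "(real^'n::finite \<Rightarrow> ('b::real_normed_vector)^'n) \<Rightarrow> real^'n \<Rightarrow> 'b" where
  "divergence X x = (\<Sum>i\<in>UNIV. partial_deriv i (\<lambda>y. X y $ i) x)"

definition lie_derivative :: "(real^'n::finite \<Rightarrow> real^'n) \<Rightarrow> (real^'n \<Rightarrow> real) \<Rightarrow> real^'n \<Rightarrow> real" where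
  "lie_derivative X f x = (\<Sum>i\<in>UNIV. X x $ i * partial_deriv i f x)"

definition zero_hypersurface :: "(real^'n::finite) set \<Rightarrow> (real^'n \<Rightarrow> real) \<Rightarrow> (real^'n) set" where
  "zero_hypersurface \<Omega> f = {x \<in> \<Omega>. f x = 0}"

definition invariant_hypersurface ::
    "(real^'n::finite) set \<Rightarrow> (real^'n \<Rightarrow> real) \<Rightarrow> (real^'n \<Rightarrow> real^'n) \<Rightarrow> bool" where
  "invariant_hypersurface \<Omega> f X \<longleftrightarrow> (\<forall>x\<in>zero_hypersurface \<Omega> f. lie_derivative X f x = 0)"

definition first_integral ::
    "(real^'n::finite) set \<Rightarrow> (real^'n \<Rightarrow> real) \<Rightarrow> (real^'n \<Rightarrow> real^'n) \<Rightarrow> bool" where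
  "first_integral \<Omega> f X \<longleftrightarrow> (\<forall>x\<in>\<Omega>. lie_derivative X f x = 0)"

text \<open>A continuous choice of \<open>log f\<close> off the zero set of \<open>f\<close>, equal to the real logarithm where
  \<open>f > 0\<close>. For integral \<open>a\<close> the power \<open>exp (a log f)\<close> does not depend on the choice.\<close>

definition log_branch :: "(real^'n::finite) set \<Rightarrow> (real^'n \<Rightarrow> real) \<Rightarrow> (real^'n \<Rightarrow> complex) \<Rightarrow> bool" where
  "log_branch \<Omega> f l \<longleftrightarrow> continuous_on (\<Omega> - zero_hypersurface \<Omega> f) l \<and>
     (\<forall>x \<in> \<Omega> - zero_hypersurface \<Omega> f.
        exp (l x) = complex_of_real (f x) \<and> (f x > 0 \<longrightarrow> l x = complex_of_real (ln (f x))))"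

definition branch_power :: "(real^'n::finite \<Rightarrow> complex) \<Rightarrow> real \<Rightarrow> real^'n \<Rightarrow> complex" where
  "branch_power l a x = exp (complex_of_real a * l x)"

definition complex_vec :: "real^'n::finite \<Rightarrow> complex^'n" where
  "complex_vec v = (\<chi> i. complex_of_real (v $ i))"

definition complex_mat :: "real^'n::finite^'n \<Rightarrow> complex^'n^'n" where
  "complex_mat A = (\<chi> i j. complex_of_real (A $ i $ j))"

definition power_field ::
    "(real^'n::finite \<Rightarrow> complex) \<Rightarrow> real \<Rightarrow> (real^'n \<Rightarrow> real^'n) \<Rightarrow> real^'n \<Rightarrow> complex^'n" where
  "power_field l r X x = branch_power l (- r) x *s complex_vec (X x)"

definition condition_a ::
    "(real^'n::finite) set \<Rightarrow> (real^'n \<Rightarrow> real) \<Rightarrow> (real^'n \<Rightarrow> complex) \<Rightarrow> real \<Rightarrow>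
      (real^'n \<Rightarrow> real^'n) \<Rightarrow> bool" where
  "condition_a \<Omega> f l r V \<longleftrightarrow>
    (\<forall>p \<in> zero_hypersurface \<Omega> f.
      ((\<lambda>x. branch_power l (r + 1) x * divergence (power_field l r V) x) \<longlongrightarrow> 0)
        (at p within (\<Omega> - zero_hypersurface \<Omega> f)))"

definition condition_b ::
    "(real^'n::finite) set \<Rightarrow> (real^'n \<Rightarrow> real) \<Rightarrow> (real^'n \<Rightarrow> complex) \<Rightarrow> real \<Rightarrow>
      (real^'n \<Rightarrow> real^'n) \<Rightarrow> bool" where
  "condition_b \<Omega> f l r V \<longleftrightarrow>
    (\<forall>p \<in> zero_hypersurface \<Omega> f. V p = 0 \<longrightarrow>
      ((\<lambda>x. branch_power l r x * divergence (power_field l r V) x) \<longlongrightarrow> 0)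
        (at p within (\<Omega> - zero_hypersurface \<Omega> f)) \<and>
      (\<forall>i. ((\<lambda>x. branch_power l (r + 1) x * partial_deriv i (divergence (power_field l r V)) x) \<longlongrightarrow> 0)
        (at p within (\<Omega> - zero_hypersurface \<Omega> f))))"

definition char_poly :: "complex^'n::finite^'n \<Rightarrow> complex poly" where
  "char_poly A = det (\<chi> i j. (if i = j then [:0, 1:] else 0) - [:A $ i $ j:])"

text \<open>Eigenvalues with algebraic multiplicity.\<close>

definition eigenvalues :: "real^'n::finite^'n \<Rightarrow> complex multiset" where
  "eigenvalues A = proots (char_poly (complex_mat A))"

definition eigenvector :: "complex^'n::finite^'n \<Rightarrow> complex \<Rightarrow> complex^'n \<Rightarrow> bool" where
  "eigenvector A \<mu> v \<longleftrightarrow> v \<noteq> 0 \<and> A *v v = \<mu> *s v"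

text \<open>A transversal eigenvector can fail to exist when \<open>\<lambda>\<^sub>j\<close> is defective: for \<open>f = x\<^sub>1\<close> and
  \<open>V = (0, x\<^sub>1)\<close> in the plane, \<open>f\<^sup>-\<^sup>r V\<close> has divergence zero, but every eigenvector
  of the linearization of \<open>V\<close> is tangent to \<open>x\<^sub>1 = 0\<close>. A transversal generalized
  eigenvector is not excluded by this example.\<close>

definition generalized_eigenvector :: "complex^'n::finite^'n \<Rightarrow> complex \<Rightarrow> complex^'n \<Rightarrow> bool" where
  "generalized_eigenvector A \<mu> v \<longleftrightarrow> v \<noteq> 0 \<and> (\<exists>k. ((\<lambda>w. A *v w - \<mu> *s w) ^^ k) v = 0)"

text \<open>The tangent space at \<open>x\<close> of a regular level set of \<open>f\<close> through \<open>x\<close> is the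
  orthogonal complement of the gradient.\<close>

definition transversal_at :: "(real^'n::finite \<Rightarrow> real) \<Rightarrow> real^'n \<Rightarrow> real^'n \<Rightarrow> bool" where
  "transversal_at f x v \<longleftrightarrow> v \<notin> {w. gradient f x \<bullet> w = 0}"

text \<open>The restriction of a tangent field to a hypersurface \<open>M\<close> is linearized in local
  coordinates: \<open>p\<close> parametrizes an open piece of \<open>M\<close>, and \<open>coordinate_field p X\<close> is the field on
  the parameter domain that \<open>p\<close> maps to \<open>X\<close>.\<close>

definition local_parametrization ::
    "nat \<Rightarrow> (real^'n::finite) set \<Rightarrow> (real^'m::finite) set \<Rightarrow> (real^'m \<Rightarrow> real^'n) \<Rightarrow> bool" where
  "local_parametrization k M U p \<longleftrightarrow>
     open U \<and> C_k_on k p U \<and> openin (top_of_set M) (p ` U) \<and>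
     (\<exists>q. homeomorphism U (p ` U) p q) \<and>
     (\<forall>u\<in>U. inj (frechet_derivative p (at u)))"

definition coordinate_field ::
    "(real^'m::finite \<Rightarrow> real^'n::finite) \<Rightarrow> (real^'n \<Rightarrow> real^'n) \<Rightarrow> real^'m \<Rightarrow> real^'m" where
  "coordinate_field p X u = (THE \<xi>. frechet_derivative p (at u) \<xi> = X (p u))"

end

theory Submission
  imports Defs "HOL-Computational_Algebra.Fundamental_Theorem_Algebra"
begin

text \<open>
  Off \<open>\<Gamma>\<close> one has \<open>f\<^sup>r D\<^sub>W = D\<^sub>V - r L\<^sub>V f / f\<close>. Multiplying by \<open>f\<close> and letting
  \<open>x\<close> tend to \<open>\<Gamma>\<close> gives the first part. At a singular point \<open>p\<close>, the first limit in (b) says that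
  \<open>L\<^sub>V f / f\<close> tends to \<open>D\<^sub>V(p) / r\<close>. Comparing the derivatives of \<open>L\<^sub>V f\<close> and \<open>f\<close> at \<open>p\<close>, the
  gradient of \<open>f\<close> is a left eigenvector of the linearization \<open>A\<close> of \<open>\<phi>V\<close> with eigenvalue
  \<open>\<mu> = tr A / r\<close>. Hence \<open>A\<close> preserves the tangent hyperplane, its characteristic polynomial is
  \<open>X - \<mu>\<close> times that of the restriction to the hyperplane, and since the range of \<open>A - \<mu>\<close> lies in the
  hyperplane, some vector annihilated by a power of \<open>A - \<mu>\<close> does not.
\<close>

section \<open>Characteristic polynomials and invariant hyperplanes\<close>

lemma poly_char_poly: "poly (char_poly A) x = det (mat x - A)"
  unfolding char_poly_def det_def
  by (simp add: poly_sum poly_prod mat_def of_int_poly if_distrib[of "\<lambda>p. poly p x"] cong: if_cong)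

text \<open>In the Leibniz sum a permutation moving \<open>k\<close> picks up a zero from row
  \<open>k\<close>. The permutations fixing \<open>k\<close> are exactly those of the remaining
  indices. The minor is indexed by another type, so \<open>e\<close> transports these permutations,
  with their signs, from \<open>'m\<close>.\<close>

lemma det_block:
  fixes M :: "'a::comm_ring_1^'n::finite^'n" and e :: "'m::finite \<Rightarrow> 'n"
  assumes e: "bij_betw e UNIV (UNIV - {k})" and row: "\<And>j. j \<noteq> k \<Longrightarrow> M $ k $ j = 0"
  shows "det M = M $ k $ k * det (\<chi> a b. M $ e a $ e b)"
proof -
  let ?t = "\<lambda>p. of_int (sign p) * (\<Prod>i\<in>UNIV. M $ i $ p i)"
  let ?h = "map_permutation UNIV e"
  have inj: "inj e" using e by (simp add: bij_betw_def)
  have h_eq: "?h = (\<lambda>\<pi> x. if x \<in> UNIV - {k} then e (\<pi> (inv_into UNIV e x)) else x)"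
    using e by (auto simp: map_permutation_def restrict_id_def bij_betw_def fun_eq_iff)
  have bij: "bij_betw ?h {p. p permutes UNIV} {p. p permutes UNIV - {k}}"
    using bij_betw_permutations[OF e] unfolding h_eq .
  have "det M = sum ?t {p. p permutes UNIV}"
    by (simp add: det_def)
  also have "\<dots> = sum ?t {p. p permutes UNIV - {k}}"
  proof (rule sum.mono_neutral_right)
    show "{p. p permutes UNIV - {k}} \<subseteq> {p. p permutes UNIV}"
      by (auto intro: permutes_subset)
    show "\<forall>p\<in>{p. p permutes UNIV} - {p. p permutes UNIV - {k}}. ?t p = 0"
    proof
      fix p assume p: "p \<in> {p. p permutes (UNIV::'n set)} - {p. p permutes UNIV - {k}}"
      then have "p k \<noteq> k" by (auto intro: permutes_superset)
      then have "(\<Prod>i\<in>UNIV. M $ i $ p i) = 0"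
        by (intro prod_zero) (auto intro!: exI[of _ k] row)
      then show "?t p = 0" by simp
    qed
  qed auto
  also have "\<dots> = (\<Sum>q | q permutes (UNIV::'m set). ?t (?h q))"
    by (rule sum.reindex_bij_betw[OF bij, symmetric])
  also have "\<dots> = (\<Sum>q | q permutes (UNIV::'m set).
      M $ k $ k * (of_int (sign q) * (\<Prod>a\<in>UNIV. M $ e a $ e (q a))))"
  proof (rule sum.cong[OF refl])
    fix q assume "q \<in> {q. q permutes (UNIV::'m set)}"
    then have q: "q permutes UNIV" by simp
    have hk: "?h q k = k" and he: "?h q (e a) = e (q a)" for a
      using e inj by (auto simp: h_eq bij_betw_def)
    have "(\<Prod>i\<in>UNIV. M $ i $ ?h q i) = M $ k $ k * (\<Prod>i\<in>UNIV - {k}. M $ i $ ?h q i)"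
      by (simp add: prod.remove[of UNIV k] hk)
    also have "(\<Prod>i\<in>UNIV - {k}. M $ i $ ?h q i) = (\<Prod>a\<in>UNIV. M $ e a $ e (q a))"
      by (subst prod.reindex_bij_betw[OF e, symmetric]) (simp add: he)
    finally show "?t (?h q) = M $ k $ k * (of_int (sign q) * (\<Prod>a\<in>UNIV. M $ e a $ e (q a)))"
      using sign_map_permutation[OF inj q] by (simp add: algebra_simps)
  qed
  also have "\<dots> = M $ k $ k * det (\<chi> a b. M $ e a $ e b)"
    by (simp add: det_def sum_distrib_left)
  finally show ?thesis .
qed

text \<open>The intertwining \<open>A ** Q = Q ** M\<close> survives adding a scalar matrix, so at
  every scalar the two determinants agree after cancelling \<open>det Q\<close>; a complex
  polynomial is determined by its values.\<close>

lemma char_poly_similar: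
  fixes A M Q Q' :: "complex^'n::finite^'n"
  assumes AQ: "A ** Q = Q ** M" and inv: "Q' ** Q = mat 1"
  shows "char_poly A = char_poly M"
proof -
  have "det Q' * det Q = 1"
    using inv by (metis det_I det_mul)
  then have nz: "det Q \<noteq> 0" by auto
  have "poly (char_poly A) x = poly (char_poly M) x" for x
  proof -
    have c: "mat x ** Q = Q ** mat x"
      by (simp add: matrix_matrix_mult_def mat_def vec_eq_iff if_distrib[of "\<lambda>a. a * _"]
          if_distrib[of "\<lambda>a. _ * a"] cong: if_cong)
    have "(mat x - A) ** Q = Q ** (mat x - M)"
      using AQ c by (simp add: matrix_matrix_mult_def vec_eq_iff algebra_simps sum_subtractf)
    then have "det (mat x - A) * det Q = det Q * det (mat x - M)"
      by (metis det_mul)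
    with nz show ?thesis by (simp add: poly_char_poly)
  qed
  then show ?thesis by (simp add: poly_eq_poly_eq_iff[symmetric] fun_eq_iff)
qed

lemma complex_mat_mult: "complex_mat (A ** B) = complex_mat A ** complex_mat B"
  by (simp add: complex_mat_def matrix_matrix_mult_def vec_eq_iff)

lemma complex_mat_1: "complex_mat (mat 1) = mat 1"
  by (simp add: complex_mat_def mat_def vec_eq_iff)

section \<open>Leading coefficients of the characteristic polynomial, and the trace\<close>

lemma coeff_prod_linear_factors:
  fixes c :: "'i \<Rightarrow> 'a::idom"
  assumes "finite S"
  shows "degree (\<Prod>i\<in>S. [:- c i, 1:]) = card S"
    and "coeff (\<Prod>i\<in>S. [:- c i, 1:]) (card S) = 1"
    and "S \<noteq> {} \<Longrightarrow> coeff (\<Prod>i\<in>S. [:- c i, 1:]) (card S - 1) = - (\<Sum>i\<in>S. c i)"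
proof -
  show deg: "degree (\<Prod>i\<in>S. [:- c i, 1:]) = card S" for S :: "'i set"
    by (subst degree_prod_sum_eq) auto
  \<comment> \<open>Stated for every set \<open>S\<close>, because the induction below applies it to
    the smaller set \<open>F\<close>.\<close>
  have monic: "coeff (\<Prod>i\<in>S. [:- c i, 1:]) (card S) = 1" for S :: "'i set"
    using lead_coeff_prod[of "\<lambda>i. [:- c i, 1:]" S] by (simp add: deg)
  show "coeff (\<Prod>i\<in>S. [:- c i, 1:]) (card S) = 1" by (rule monic)
  show "coeff (\<Prod>i\<in>S. [:- c i, 1:]) (card S - 1) = - (\<Sum>i\<in>S. c i)" if "S \<noteq> {}"
    using assms that
  proof (induction S rule: finite_ne_induct)
    case (insert x F)
    then obtain n where n: "card F = Suc n"
      by (metis card_0_eq not0_implies_Suc)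
    show ?case
      using insert monic[of F] by (simp add: n)
  qed simp
qed

text \<open>A permutation other than the identity moves at least two indices, and each moved index
  contributes a constant entry. Its term therefore has degree at most \<open>CARD('n) - 2\<close>,
  and the two top coefficients come from the diagonal alone.\<close>

lemma coeff_char_poly:
  fixes A :: "complex^'n::finite^'n"
  assumes "k + 1 \<ge> CARD('n)"
  shows "coeff (char_poly A) k = coeff (\<Prod>i\<in>UNIV. [:- (A $ i $ i), 1:]) k"
proof -
  let ?N = "\<chi> i j. (if i = j then [:0, 1:] else 0) - [:A $ i $ j:]"
  let ?t = "\<lambda>p. of_int (sign p) * (\<Prod>i\<in>UNIV. ?N $ i $ p i)"
  have zero: "coeff (?t p) k = 0" if p: "p permutes UNIV" "p \<noteq> id" for p
  proof -
    let ?F = "{i. p i = i}"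
    obtain i where i: "p i \<noteq> i" using p by fastforce
    \<comment> \<open>By injectivity \<open>p i\<close> is moved as well, so two distinct points are
      missing from the fixed-point set.\<close>
    moreover have "p (p i) \<noteq> p i" using p i by (metis permutes_inverses(2))
    ultimately have "?F \<subseteq> UNIV - {i, p i}" by auto
    then have "card ?F \<le> card (UNIV - {i, p i})" by (rule card_mono[rotated]) simp
    also have "\<dots> = CARD('n) - 2" using i by (subst card_Diff_subset) auto
    finally have cF: "card ?F \<le> CARD('n) - 2" .
    \<comment> \<open>This keeps the natural-number subtraction \<open>CARD('n) - 2\<close> from
      truncating, so the degree bound really lies below \<open>k\<close>.\<close>
    have "card {i, p i} \<le> CARD('n)" by (rule card_mono) auto
    then have n2: "CARD('n) \<ge> 2" using i by auto
    have "degree (\<Prod>i\<in>UNIV. ?N $ i $ p i) \<le> (\<Sum>i\<in>UNIV. degree (?N $ i $ p i))"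
      using degree_prod_sum_le[of UNIV "\<lambda>i. ?N $ i $ p i"] by (simp add: o_def)
    also have "\<dots> \<le> (\<Sum>i\<in>UNIV. if p i = i then 1 else 0)"
      by (rule sum_mono) auto
    also have "\<dots> = card ?F" by (simp add: sum.If_cases)
    also have "\<dots> < k" using cF n2 assms by linarith
    finally have "coeff (\<Prod>i\<in>UNIV. ?N $ i $ p i) k = 0" by (rule coeff_eq_0)
    then show ?thesis by (simp add: of_int_poly)
  qed
  have "char_poly A = sum ?t {p. p permutes UNIV}"
    by (simp add: char_poly_def det_def)
  also have "\<dots> = ?t id + sum ?t ({p. p permutes UNIV} - {id})"
    by (rule sum.remove) (auto simp: permutes_id)
  finally have "coeff (char_poly A) k = coeff (?t id) k + (\<Sum>p\<in>{p. p permutes UNIV} - {id}. coeff (?t p) k)"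
    by (simp add: coeff_sum)
  also have "\<dots> = coeff (?t id) k" using zero by simp
  also have "?t id = (\<Prod>i\<in>UNIV. [:- (A $ i $ i), 1:])" by simp
  finally show ?thesis .
qed

lemma char_poly_monic:
  fixes A :: "complex^'n::finite^'n"
  shows "degree (char_poly A) = CARD('n)" and "lead_coeff (char_poly A) = 1"
proof -
  let ?P = "\<Prod>i\<in>UNIV. [:- (A $ i $ i), 1:]"
  have P: "degree ?P = CARD('n)" "coeff ?P (CARD('n)) = 1"
    by (rule coeff_prod_linear_factors; simp)+
  have "degree (char_poly A) \<le> CARD('n)"
    by (rule degree_le) (auto simp: coeff_char_poly coeff_eq_0 P)
  moreover have "coeff (char_poly A) (CARD('n)) = 1" by (simp add: coeff_char_poly P)
  ultimately show "degree (char_poly A) = CARD('n)"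
    by (metis antisym le_degree one_neq_zero)
  with \<open>coeff (char_poly A) (CARD('n)) = 1\<close> show "lead_coeff (char_poly A) = 1" by simp
qed

lemma char_poly_nonzero: "char_poly A \<noteq> 0"
  using char_poly_monic(2)[of A] by auto

text \<open>Over the complex numbers the monic characteristic polynomial splits into linear factors.
  Its coefficient of degree \<open>CARD('n) - 1\<close> is read off once from the roots and once
  from the diagonal.\<close>

lemma sum_eigenvalues:
  fixes A :: "complex^'n::finite^'n" and ev :: "'n \<Rightarrow> complex"
  assumes "proots (char_poly A) = image_mset ev (mset_set UNIV)"
  shows "(\<Sum>i\<in>UNIV. ev i) = trace A"
proof -
  have "char_poly A = (\<Prod>x\<in>#proots (char_poly A). [:- x, 1:])"
    using complex_poly_decompose_multiset[of "char_poly A"] char_poly_monic(2)[of A] by simp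
  also have "\<dots> = (\<Prod>i\<in>UNIV. [:- ev i, 1:])"
    by (simp add: assms prod_unfold_prod_mset image_mset.compositionality o_def)
  finally have "coeff (char_poly A) (CARD('n) - 1) = - (\<Sum>i\<in>UNIV. ev i)"
    using coeff_prod_linear_factors(3)[of UNIV ev] by simp
  moreover have "coeff (char_poly A) (CARD('n) - 1) = - (\<Sum>i\<in>UNIV. A $ i $ i)"
    using coeff_prod_linear_factors(3)[of UNIV "\<lambda>i. A $ i $ i"] by (simp add: coeff_char_poly)
  ultimately show ?thesis by (simp add: trace_def)
qed

section \<open>Splitting the spectrum along an invariant hyperplane\<close>

lemma eigenvalue_in_eigenvalues:
  fixes C :: "real^'m::finite^'m"
  assumes "C *v c = \<mu> *s c" "c \<noteq> 0"
  shows "complex_of_real \<mu> \<in># eigenvalues C"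
proof -
  let ?c = "complex_vec c"
  have "(mat (complex_of_real \<mu>) - complex_mat C) *v ?c = 0"
  proof -
    have "complex_mat C *v ?c = complex_vec (C *v c)"
      by (simp add: complex_mat_def complex_vec_def matrix_vector_mult_def vec_eq_iff)
    also have "\<dots> = complex_of_real \<mu> *s ?c"
      by (simp add: assms complex_vec_def vec_eq_iff)
    also have "\<dots> = mat (complex_of_real \<mu>) *v ?c"
      by (simp add: mat_def matrix_vector_mult_def vec_eq_iff if_distrib[of "\<lambda>a. a * _"] cong: if_cong)
    finally show ?thesis by (simp add: matrix_vector_mult_diff_rdistrib)
  qed
  moreover have "?c \<noteq> 0" using assms(2) by (auto simp: complex_vec_def vec_eq_iff)
  ultimately have "\<not> invertible (mat (complex_of_real \<mu>) - complex_mat C)"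
    by (metis invertible_left_inverse matrix_left_invertible_ker)
  then have "poly (char_poly (complex_mat C)) (complex_of_real \<mu>) = 0"
    by (simp add: poly_char_poly invertible_det_nz)
  then show ?thesis by (simp add: eigenvalues_def char_poly_nonzero)
qed

text \<open>In the basis consisting of \<open>w\<close> and the columns of \<open>P\<close>, the matrix \<open>A\<close> is block triangular
  with diagonal blocks \<open>\<mu>\<close> and \<open>C\<close>.\<close>

lemma eigenvalues_invariant_hyperplane:
  fixes A :: "real^'n::finite^'n" and C :: "real^'m::finite^'m" and P :: "real^'m^'n"
  assumes card: "CARD('m) + 1 = CARD('n)" and w: "w \<noteq> 0"
    and left: "\<And>h. w \<bullet> (A *v h) = \<mu> * (w \<bullet> h)"
    and AP: "A ** P = P ** C"
    and inj: "\<And>c. P *v c = 0 \<Longrightarrow> c = 0"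
    and range: "range ((*v) P) = {h. w \<bullet> h = 0}"
  shows "eigenvalues A = add_mset (complex_of_real \<mu>) (eigenvalues C)"
proof -
  fix k :: 'n
  have "card (UNIV - {k}) = CARD('m)" using card by simp
  then obtain e where e: "bij_betw e (UNIV::'m set) (UNIV - {k})"
    by (metis finite finite_same_card_bij)
  define d where "d = inv_into UNIV e"
  have de: "d (e a) = a" and ek: "e a \<noteq> k" for a
    using e by (auto simp: d_def bij_betw_def)
  have ed: "e (d i) = i" if "i \<noteq> k" for i
    using e that by (auto simp: d_def bij_betw_def f_inv_into_f)
  \<comment> \<open>The hypothesis \<open>left\<close> makes this vector orthogonal to
    \<open>w\<close>; its coordinates \<open>z\<close> fill the off-diagonal part of column
    \<open>k\<close> of \<open>M\<close>. The index \<open>k\<close> is arbitrary and serves as the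
    slot of the basis vector \<open>w\<close>.\<close>
  have "A *v w - \<mu> *\<^sub>R w \<in> range ((*v) P)"
    using left[of w] by (simp add: range inner_diff_right)
  then obtain z where z: "A *v w - \<mu> *\<^sub>R w = P *v z" by auto
  define Q where "Q = (\<chi> i j. if j = k then w $ i else P $ i $ d j)"
  define M where "M = (\<chi> i j. if i = k then (if j = k then \<mu> else 0)
                   else if j = k then z $ d i else C $ d i $ d j)"
  have sum_split: "(\<Sum>j\<in>UNIV. g j) = g k + (\<Sum>a\<in>UNIV. g (e a))" for g :: "'n \<Rightarrow> real"
    by (simp add: sum.remove[of UNIV k] sum.reindex_bij_betw[OF e])
  have AQ: "A ** Q = Q ** M"
  proof -
    have "(A ** Q) $ i $ j = (Q ** M) $ i $ j" for i j
    proof (cases "j = k")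
      case True
      have "(A *v w) $ i = \<mu> * w $ i + (P *v z) $ i"
        by (simp flip: z)
      moreover have "(Q ** M) $ i $ j = \<mu> * w $ i + (P *v z) $ i"
        using True by (simp add: matrix_matrix_mult_def sum_split[of "\<lambda>a. Q $ i $ a * M $ a $ k"])
          (simp add: Q_def M_def ek de matrix_vector_mult_def)
      ultimately show ?thesis
        using True by (simp add: matrix_matrix_mult_def matrix_vector_mult_def Q_def)
    next
      case False
      have "(A ** P) $ i $ d j = (P ** C) $ i $ d j" by (simp add: AP)
      moreover have "(Q ** M) $ i $ j = (\<Sum>a\<in>UNIV. P $ i $ a * C $ a $ d j)"
        using False by (simp add: matrix_matrix_mult_def sum_split[of "\<lambda>a. Q $ i $ a * M $ a $ j"])
          (simp add: Q_def M_def ek de)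
      ultimately show ?thesis
        using False by (simp add: matrix_matrix_mult_def Q_def)
    qed
    then show ?thesis by (simp add: vec_eq_iff)
  qed
  have Qy: "Q *v y = (y $ k) *\<^sub>R w + P *v (\<chi> a. y $ e a)" for y
  proof -
    have "(Q *v y) $ i = (y $ k) * w $ i + (P *v (\<chi> a. y $ e a)) $ i" for i
      by (simp add: matrix_vector_mult_def sum_split[of "\<lambda>a. Q $ i $ a * y $ a"])
        (simp add: Q_def ek de)
    then show ?thesis by (simp add: vec_eq_iff)
  qed
  \<comment> \<open>Pairing \<open>Q *v y\<close> with \<open>w\<close> kills the part in the
    hyperplane and isolates \<open>y $ k\<close>; injectivity of \<open>P\<close> handles the other
    entries.\<close>
  have "y = 0" if "Q *v y = 0" for y
  proof -
    have "w \<bullet> (P *v (\<chi> a. y $ e a)) = 0" using range by auto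
    with that have "y $ k * (w \<bullet> w) = 0" by (metis Qy inner_add_right inner_scaleR_right inner_zero_right add.right_neutral)
    with w have yk: "y $ k = 0" by simp
    with that have "(\<chi> a. y $ e a) = 0" by (intro inj) (simp add: Qy)
    then have "y $ e a = 0" for a by (simp add: vec_eq_iff)
    with yk ed show ?thesis by (metis vec_eq_iff zero_index)
  qed
  then obtain Q' where Q': "Q' ** Q = mat 1" using matrix_left_invertible_ker by blast
  \<comment> \<open>The change of basis is real; only the resulting matrix identities are carried
    over to the complex matrices.\<close>
  have char: "char_poly (complex_mat A) = char_poly (complex_mat M)"
    using AQ Q' by (intro char_poly_similar[of _ "complex_mat Q" _ "complex_mat Q'"])
      (simp_all flip: complex_mat_mult complex_mat_1)
  also have "\<dots> = [:- complex_of_real \<mu>, 1:] * char_poly (complex_mat C)"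
  proof -
    have "char_poly (complex_mat M) = [:- complex_of_real \<mu>, 1:] *
        det (\<chi> a b. (\<chi> i j. (if i = j then [:0, 1:] else 0) - [:complex_mat M $ i $ j:]) $ e a $ e b)"
      unfolding char_poly_def
      by (subst det_block[OF e]) (simp_all add: complex_mat_def M_def)
    moreover have "e a = e b \<longleftrightarrow> a = b" for a b by (metis de)
    ultimately show ?thesis
      by (simp add: char_poly_def complex_mat_def M_def ek de cong: if_cong)
  qed
  finally have "proots (char_poly (complex_mat A)) =
      proots [:- complex_of_real \<mu>, 1:] + proots (char_poly (complex_mat C))"
    by (simp only:) (rule proots_mult, simp_all add: char_poly_nonzero)
  then show ?thesis by (simp add: eigenvalues_def)
qed

text \<open>Provides linear coordinates on the tangent hyperplane when no parametrization of the
  hypersurface is given; it rests on equality of dimensions.\<close>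

lemma hyperplane_parametrization:
  fixes w :: "real^'n::finite"
  assumes "CARD('m::finite) + 1 = CARD('n)" "w \<noteq> 0"
  obtains D :: "real^'m \<Rightarrow> real^'n" where "linear D" "inj D" "range D = {h. w \<bullet> h = 0}"
proof -
  have "dim (UNIV :: (real^'m) set) = dim {h. w \<bullet> h = 0}"
    using assms by (simp add: dim_hyperplane)
  then show thesis
    using subspace_isomorphism[OF subspace_UNIV subspace_hyperplane] that by blast
qed

text \<open>By \<open>left\<close> the hyperplane is mapped into itself, so \<open>A\<close> can be
  read in the coordinates \<open>D\<close>. The statement takes an arbitrary \<open>D\<close> in
  order to cover both an abstract choice of coordinates and the derivative of a
  parametrization.\<close>

lemma hyperplane_compression:
  fixes A :: "real^'n::finite^'n" and D :: "real^'m::finite \<Rightarrow> real^'n"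
  assumes card: "CARD('m) + 1 = CARD('n)" and w: "w \<noteq> 0"
    and left: "\<And>h. w \<bullet> (A *v h) = \<mu> * (w \<bullet> h)"
    and D: "linear D" "inj D" "range D = {h. w \<bullet> h = 0}"
  obtains C where "\<And>h. A *v D h = D (C *v h)"
    and "eigenvalues A = add_mset (complex_of_real \<mu>) (eigenvalues C)"
proof -
  define P where "P = matrix D"
  have P: "P *v h = D h" for h
    using D(1) by (simp add: P_def matrix_works)
  have "\<exists>c. P *v c = A *v (P *v axis j 1)" for j
  proof -
    have "w \<bullet> (P *v axis j 1) = 0" using D(3) by (auto simp: P)
    then have "A *v (P *v axis j 1) \<in> range D" by (simp add: left D(3))
    then show ?thesis by (auto simp: P)
  qed
  then obtain c where c: "\<And>j. P *v c j = A *v (P *v axis j 1)" by metis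
  \<comment> \<open>Column \<open>j\<close> of \<open>C\<close> consists of the coordinates of the
    image under \<open>A\<close> of the \<open>j\<close>-th column of \<open>P\<close>.\<close>
  define C where "C = (\<chi> a j. c j $ a)"
  have AP: "A ** P = P ** C"
  proof -
    have "(A ** P) $ i $ j = (P ** C) $ i $ j" for i j
    proof -
      have "(A ** P) $ i $ j = (A *v (P *v axis j 1)) $ i"
        unfolding matrix_vector_mul_assoc by (simp add: matrix_vector_mult_basis column_def)
      also have "\<dots> = (P ** C) $ i $ j"
        by (simp flip: c) (simp add: matrix_matrix_mult_def matrix_vector_mult_def C_def)
      finally show ?thesis .
    qed
    then show ?thesis by (simp add: vec_eq_iff)
  qed
  show thesis
  proof
    show "A *v D h = D (C *v h)" for h
      by (simp flip: P) (simp add: matrix_vector_mul_assoc AP)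
    show "eigenvalues A = add_mset (complex_of_real \<mu>) (eigenvalues C)"
    proof (rule eigenvalues_invariant_hyperplane[OF card w left AP])
      show "range ((*v) P) = {h. w \<bullet> h = 0}" using D(3) by (simp add: P[abs_def])
      show "h = 0" if "P *v h = 0" for h
        using that D by (metis P injD linear_0)
    qed
  qed
qed

section \<open>Eigenvectors and generalized eigenvectors transversal to a hyperplane\<close>

lemma linear_funpow:
  fixes B :: "'a::real_vector \<Rightarrow> 'a"
  assumes "linear B"
  shows "linear (B ^^ k)"
proof (induction k)
  case 0
  show ?case by (simp add: linear_iff)
next
  case (Suc k)
  then show ?case using assms by (simp add: linear_iff)
qed

text \<open>The ranges of the iterates form a decreasing chain of subspaces. At an exponent where
  the dimension is least, the next range has the same dimension and so coincides.\<close>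

lemma linear_funpow_range_stable:
  fixes B :: "'a::euclidean_space \<Rightarrow> 'a"
  assumes "linear B"
  obtains k where "range (B ^^ k) = range (B ^^ Suc k)"
proof -
  have lin: "linear (B ^^ k)" for k by (rule linear_funpow[OF assms])
  have sub: "range (B ^^ Suc k) \<subseteq> range (B ^^ k)" for k
    by (subst funpow_Suc_right) auto
  obtain k where k: "\<And>j. dim (range (B ^^ k)) \<le> dim (range (B ^^ j))"
    using ex_has_least_nat[of "\<lambda>_. True" _ "\<lambda>k. dim (range (B ^^ k))"] by auto
  have "range (B ^^ Suc k) = range (B ^^ k)"
    using sub[of k] k[of "Suc k"] linear_subspace_image[OF lin[of k] subspace_UNIV]
      linear_subspace_image[OF lin[of "Suc k"] subspace_UNIV]
    by (intro subspace_dim_equal)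
  then show thesis by (metis that)
qed

text \<open>When the ranges have stabilized at \<open>k\<close>, \<open>(B ^^ k) w\<close> equals
  \<open>(B ^^ k) (B x)\<close> for some \<open>x\<close>, so \<open>w - B x\<close> is annihilated.
  Since \<open>B x\<close> is orthogonal to \<open>w\<close>, subtracting it does not change the
  component along \<open>w\<close>. It is applied to \<open>B\<close> = \<open>A\<close> minus
  \<open>\<mu>\<close>.\<close>

lemma transversal_generalized_eigenvector:
  fixes B :: "'a::euclidean_space \<Rightarrow> 'a"
  assumes B: "linear B" and w: "w \<noteq> 0" and left: "\<And>h. w \<bullet> B h = 0"
  obtains v k where "(B ^^ k) v = 0" "w \<bullet> v \<noteq> 0"
proof -
  obtain k where k: "range (B ^^ k) = range (B ^^ Suc k)"
    using linear_funpow_range_stable[OF B] .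
  have lin: "linear (B ^^ k)" by (rule linear_funpow[OF B])
  have "(B ^^ k) w \<in> range (B ^^ Suc k)" using k by auto
  then obtain x where x: "(B ^^ k) w = (B ^^ k) (B x)"
    by (auto simp: funpow_swap1)
  show thesis
  proof
    show "(B ^^ k) (w - B x) = 0" using x linear_diff[OF lin] by simp
    show "w \<bullet> (w - B x) \<noteq> 0" using w left by (simp add: inner_diff_right)
  qed
qed

text \<open>The map \<open>B\<close> sends the hyperplane into itself and, by \<open>ker\<close>,
  injectively, hence onto it. So \<open>B w\<close>, which lies in the hyperplane, equals
  \<open>B t\<close> for a tangent \<open>t\<close>, and \<open>w - t\<close> is the required kernel
  vector.\<close>

lemma transversal_eigenvector:
  fixes B :: "'a::euclidean_space \<Rightarrow> 'a"
  assumes B: "linear B" and w: "w \<noteq> 0" and left: "\<And>h. w \<bullet> B h = 0"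
    and ker: "\<And>h. w \<bullet> h = 0 \<Longrightarrow> B h = 0 \<Longrightarrow> h = 0"
  obtains v where "B v = 0" "w \<bullet> v \<noteq> 0"
proof -
  let ?T = "{h. w \<bullet> h = 0}"
  have sT: "subspace ?T" by (rule subspace_hyperplane)
  have "inj_on B ?T"
  proof (rule inj_onI)
    fix x y assume "x \<in> ?T" "y \<in> ?T" "B x = B y"
    then show "x = y" using ker[of "x - y"] linear_diff[OF B] by (simp add: inner_diff_right)
  qed
  then have "dim (B ` ?T) = dim ?T"
    by (intro dim_image_eq[OF B]) (simp add: span_eq_iff[THEN iffD2, OF sT])
  then have "B ` ?T = ?T"
    using sT linear_subspace_image[OF B sT] left by (intro subspace_dim_equal) auto
  moreover have "B w \<in> ?T" using left by simp
  ultimately obtain t where t: "w \<bullet> t = 0" "B w = B t" by auto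
  show thesis
    using w t by (intro that[of "w - t"]) (simp_all add: linear_diff[OF B] inner_diff_right)
qed

lemma complex_vec_linear:
  "complex_mat A *v complex_vec v = complex_vec (A *v v)"
  "complex_of_real c *s complex_vec v = complex_vec (c *\<^sub>R v)"
  "complex_vec u - complex_vec v = complex_vec (u - v)"
  by (simp_all add: complex_mat_def complex_vec_def matrix_vector_mult_def vec_eq_iff)

lemma complex_vec_eq_0_iff: "complex_vec v = 0 \<longleftrightarrow> v = 0"
  by (simp add: complex_vec_def vec_eq_iff)

lemma generalized_eigenvector_real:
  assumes "((\<lambda>h. A *v h - c *\<^sub>R h) ^^ k) v = 0" "v \<noteq> 0"
  shows "generalized_eigenvector (complex_mat A) (complex_of_real c) (complex_vec v)"
proof -
  have "((\<lambda>w. complex_mat A *v w - complex_of_real c *s w) ^^ k) (complex_vec v)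
      = complex_vec (((\<lambda>h. A *v h - c *\<^sub>R h) ^^ k) v)"
    by (induction k) (simp_all add: complex_vec_linear)
  with assms have "((\<lambda>w. complex_mat A *v w - complex_of_real c *s w) ^^ k) (complex_vec v) = 0"
    by (simp add: complex_vec_eq_0_iff)
  with assms(2) show ?thesis
    unfolding generalized_eigenvector_def complex_vec_eq_0_iff by blast
qed

lemma linear_matrix_minus_scale: "linear (\<lambda>h. A *v h - c *\<^sub>R (h::real^'n::finite))"
  by (intro linear_compose_sub matrix_vector_mul_linear linear_compose_scale_right linear_id[unfolded id_def])

text \<open>Every hyperplane is the image of an injective linear map, so simplicity of \<open>\<mu>\<close> can be tested
  on the compression of \<open>A\<close> to the hyperplane.\<close>

lemma simple_eigenvalue_transversal:
  fixes A :: "real^'n::finite^'n"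
  assumes card: "CARD('m::finite) + 1 = CARD('n)" and w: "w \<noteq> 0"
    and left: "\<And>h. w \<bullet> (A *v h) = \<mu> * (w \<bullet> h)"
    and simple: "count (eigenvalues A) (complex_of_real \<mu>) \<le> 1"
  obtains v where "A *v v = \<mu> *\<^sub>R v" "w \<bullet> v \<noteq> 0"
proof -
  obtain D :: "real^'m \<Rightarrow> real^'n" where D: "linear D" "inj D" "range D = {h. w \<bullet> h = 0}"
    using hyperplane_parametrization[OF card w] .
  obtain C where AC: "\<And>h. A *v D h = D (C *v h)"
    and eig: "eigenvalues A = add_mset (complex_of_real \<mu>) (eigenvalues C)"
    using hyperplane_compression[OF card w left D] by blast
  show thesis
  proof (rule transversal_eigenvector[OF linear_matrix_minus_scale w, of A \<mu>])
    show "w \<bullet> (A *v h - \<mu> *\<^sub>R h) = 0" for h by (simp add: inner_diff_right left)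
    \<comment> \<open>A nonzero tangent kernel vector would be, in the coordinates \<open>D\<close>,
      an eigenvector of \<open>C\<close> for \<open>\<mu>\<close>. That gives a second occurrence of
      \<open>\<mu>\<close> in the spectrum of \<open>A\<close>, against simplicity.\<close>
    show "h = 0" if h: "w \<bullet> h = 0" "A *v h - \<mu> *\<^sub>R h = 0" for h
    proof (rule ccontr)
      assume "h \<noteq> 0"
      have "h \<in> range D" using h(1) D(3) by simp
      then obtain c where c: "h = D c" by auto
      have "D (C *v c) = D (\<mu> *s c)"
        using h(2) unfolding c AC by (simp add: scalar_mult_eq_scaleR linear_cmul[OF D(1)])
      then have "C *v c = \<mu> *s c" using D(2) by (simp add: inj_eq)
      moreover have "c \<noteq> 0" using c \<open>h \<noteq> 0\<close> linear_0[OF D(1)] by auto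
      ultimately have "complex_of_real \<mu> \<in># eigenvalues C" by (rule eigenvalue_in_eigenvalues)
      then have "count (eigenvalues C) (complex_of_real \<mu>) \<ge> 1" by (simp add: Suc_le_eq)
      with simple eig show False by simp
    qed
    fix v assume "A *v v - \<mu> *\<^sub>R v = 0" "w \<bullet> v \<noteq> 0"
    then show thesis by (intro that) auto
  qed
qed

section \<open>Partial derivatives\<close>

lemma partial_deriv_eq:
  assumes "(g has_derivative D) (at x)"
  shows "partial_deriv i g x = D (axis i 1)"
proof -
  have "((\<lambda>t. x + t *\<^sub>R axis i 1) has_derivative (\<lambda>t. t *\<^sub>R axis i 1)) (at 0)"
    by (auto intro!: derivative_eq_intros)
  then have "((\<lambda>t. g (x + t *\<^sub>R axis i 1)) has_derivative (\<lambda>t. D (t *\<^sub>R axis i 1))) (at 0)"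
    by (rule has_derivative_compose) (use assms in simp)
  moreover have "linear D" using assms by (rule has_derivative_linear)
  ultimately have "((\<lambda>t. g (x + t *\<^sub>R axis i 1)) has_vector_derivative D (axis i 1)) (at 0)"
    by (simp add: has_vector_derivative_def linear_cmul)
  then show ?thesis by (simp add: partial_deriv_def vector_derivative_at)
qed

lemma has_derivative_partial_deriv:
  assumes "(g has_derivative D) (at x)"
  shows "D h = (\<Sum>i\<in>UNIV. (h $ i) *\<^sub>R partial_deriv i g x)"
proof -
  have lin: "linear D" using assms by (rule has_derivative_linear)
  have "D h = D (\<Sum>i\<in>UNIV. (h $ i) *\<^sub>R axis i 1)"
    by (simp add: basis_expansion[of h, unfolded scalar_mult_eq_scaleR])
  also have "\<dots> = (\<Sum>i\<in>UNIV. (h $ i) *\<^sub>R partial_deriv i g x)"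
    by (simp add: linear_sum[OF lin] linear_cmul[OF lin] partial_deriv_eq[OF assms])
  finally show ?thesis .
qed

lemma has_derivative_gradient:
  assumes "f differentiable (at x)"
  shows "(f has_derivative (\<lambda>h. gradient f x \<bullet> h)) (at x)"
proof -
  obtain D where D: "(f has_derivative D) (at x)"
    using assms by (auto simp: differentiable_def)
  have "D = (\<lambda>h. gradient f x \<bullet> h)"
    by (rule ext) (simp add: has_derivative_partial_deriv[OF D] gradient_def inner_vec_def mult.commute)
  with D show ?thesis by simp
qed

lemma partial_deriv_component:
  assumes "V differentiable (at x)"
  shows "partial_deriv i (\<lambda>y. V y $ j) x = partial_deriv i V x $ j"
proof -
  obtain D where D: "(V has_derivative D) (at x)"
    using assms by (auto simp: differentiable_def)
  have "((\<lambda>y. V y $ j) has_derivative (\<lambda>h. D h $ j)) (at x)"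
    by (rule bounded_linear.has_derivative[OF bounded_linear_vec_nth D])
  then show ?thesis using D by (simp add: partial_deriv_eq)
qed

lemma differentiable_component:
  "V differentiable (at x) \<Longrightarrow> (\<lambda>y. V y $ j) differentiable (at x)"
  unfolding differentiable_def by (blast intro: bounded_linear.has_derivative[OF bounded_linear_vec_nth])

lemma divergence_eq_trace:
  assumes "V differentiable (at x)"
  shows "divergence V x = trace (jacobian V (at x))"
proof -
  have "(V has_derivative (\<lambda>h. jacobian V (at x) *v h)) (at x)"
    using assms by (simp add: jacobian_works)
  then have "partial_deriv i V x $ i = jacobian V (at x) $ i $ i" for i
    by (simp add: partial_deriv_eq matrix_vector_mult_basis column_def)
  then show ?thesis
    by (simp add: divergence_def trace_def partial_deriv_component[OF assms])
qed

lemma lie_derivative_gradient: "lie_derivative V f x = gradient f x \<bullet> V x"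
  by (simp add: lie_derivative_def gradient_def inner_vec_def mult.commute)

lemma C_k_on_differentiable:
  assumes "C_k_on s g S" "s \<ge> 1" "open S" "x \<in> S"
  shows "g differentiable (at x)"
  using assms by (cases s) (auto simp: differentiable_on_eq_differentiable_at)

lemma C_k_on_partial_deriv_differentiable:
  assumes "C_k_on s g S" "s \<ge> 2" "open S" "x \<in> S"
  shows "partial_deriv i g differentiable (at x)"
proof -
  obtain k where "s = Suc (Suc k)" using assms(2) by (metis Suc_le_D numeral_2_eq_2 Suc_le_mono)
  with assms show ?thesis by (auto simp: differentiable_on_eq_differentiable_at)
qed

lemma branch_power_mult_inverse: "branch_power l r x * branch_power l (- r) x = 1"
  by (simp add: branch_power_def flip: exp_add)

text \<open>Differentiates a field given implicitly by linear equations with varying coefficients,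
  as a coordinate field is. Continuity of \<open>T\<close> at \<open>a\<close> suffices because
  \<open>Y\<close> vanishes there: \<open>T u\<close> applied to the error
  \<open>Y u - C (u - a)\<close> is small, and the lower bound on \<open>T a\<close> controls the
  error itself.\<close>

lemma has_derivative_solution:
  fixes T :: "'a::real_normed_vector \<Rightarrow> 'b::real_normed_vector \<Rightarrow> 'c::real_normed_vector"
  assumes lin: "\<And>u. linear (T u)"
    and cont: "\<And>\<eta>. \<eta> > 0 \<Longrightarrow> \<forall>\<^sub>F u in at a. \<forall>\<xi>. norm (T u \<xi> - T a \<xi>) \<le> \<eta> * norm \<xi>"
    and c: "c > 0" and below: "\<And>\<xi>. c * norm \<xi> \<le> norm (T a \<xi>)"
    and F: "(F has_derivative F') (at a)" "F a = 0"
    and Y: "\<forall>\<^sub>F u in at a. T u (Y u) = F u" "Y a = 0"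
    and C: "bounded_linear C" "\<And>h. T a (C h) = F' h"
  shows "(Y has_derivative C) (at a)"
  unfolding has_derivative_within_alt2
proof (intro conjI C(1) allI impI)
  fix e :: real assume e: "e > 0"
  obtain K where K: "K > 0" "\<And>h. norm (C h) \<le> norm h * K"
    using bounded_linear.pos_bounded[OF C(1)] by auto
  \<comment> \<open>The bound \<open>c / 2\<close> lets the term \<open>\<eta> * norm ?d\<close> be
    absorbed on the left; the other bound makes the error from replacing \<open>T u\<close> by
    \<open>T a\<close> on \<open>C ?h\<close> at most \<open>e * c / 4 * norm ?h\<close>.\<close>
  define \<eta> where "\<eta> = min (c / 2) (e * c / (4 * K))"
  have \<eta>: "\<eta> > 0" "\<eta> \<le> c / 2" "\<eta> * K \<le> e * c / 4"
    using e c K(1) mult_right_mono[of \<eta> "e * c / (4 * K)" K] by (auto simp: \<eta>_def)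
  have "\<forall>\<^sub>F u in at a. norm (F u - F a - F' (u - a)) \<le> e * c / 4 * norm (u - a)"
    using F(1) e c unfolding has_derivative_within_alt2 by (meson divide_pos_pos mult_pos_pos zero_less_numeral)
  with cont[OF \<eta>(1)] Y(1)
  show "\<forall>\<^sub>F u in at a. norm (Y u - Y a - C (u - a)) \<le> e * norm (u - a)"
  proof eventually_elim
    case (elim u)
    let ?h = "u - a" and ?d = "Y u - C (u - a)"
    have "T u ?d = (F u - F' ?h) - (T u (C ?h) - T a (C ?h))"
      using elim(2) C(2) by (simp add: linear_diff[OF lin])
    also have "norm \<dots> \<le> e * c / 4 * norm ?h + \<eta> * norm (C ?h)"
      by (rule order_trans[OF norm_triangle_ineq4 add_mono]) (use elim(1,3) F(2) in auto)
    also have "\<eta> * norm (C ?h) \<le> \<eta> * K * norm ?h"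
      using K(2)[of ?h] \<eta>(1) by (simp add: mult_left_mono ac_simps)
    also have "\<dots> \<le> e * c / 4 * norm ?h"
      using \<eta>(3) by (intro mult_right_mono) auto
    finally have Tu: "norm (T u ?d) \<le> e * c / 2 * norm ?h" by (simp add: ac_simps)
    have "c * norm ?d \<le> norm (T a ?d)" by (rule below)
    also have "\<dots> \<le> norm (T u ?d) + norm (T u ?d - T a ?d)"
      by (metis norm_minus_commute norm_triangle_sub)
    also have "\<dots> \<le> e * c / 2 * norm ?h + c / 2 * norm ?d"
      using elim(1) \<eta>(2) Tu by (intro add_mono order_trans[OF spec[OF elim(1)]] mult_right_mono) auto
    finally have "c * norm ?d \<le> c * (e * norm ?h)" by (simp add: ac_simps)
    then show ?case using c Y(2) by simp
  qed
qed

section \<open>Divergence of a field scaled by a power of the defining function\<close>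

text \<open>Only \<open>f\<close> and its logarithm are fixed here. The field stays a parameter of
  the lemmas, since some are applied to \<open>V\<close> and others to its multiple by
  \<open>\<phi>\<close>.\<close>

locale regular_log_branch =
  fixes \<Omega> :: "(real^'n::finite) set" and f :: "real^'n \<Rightarrow> real" and l :: "real^'n \<Rightarrow> complex"
  assumes open_domain: "open \<Omega>"
    and diff_f: "x \<in> \<Omega> \<Longrightarrow> f differentiable (at x)"
    and diff_partial_f: "x \<in> \<Omega> \<Longrightarrow> partial_deriv i f differentiable (at x)"
    and regular: "x \<in> zero_hypersurface \<Omega> f \<Longrightarrow> gradient f x \<noteq> 0"
    and branch: "log_branch \<Omega> f l"
begin

abbreviation "\<Gamma> \<equiv> zero_hypersurface \<Omega> f"

lemma continuous_f: "continuous_on \<Omega> f"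
  using diff_f open_domain by (simp add: continuous_on_eq_continuous_at differentiable_imp_continuous_within)

lemma open_complement: "open (\<Omega> - \<Gamma>)"
proof -
  have "\<Omega> - \<Gamma> = \<Omega> \<inter> f -` (- {0})" by (auto simp: zero_hypersurface_def)
  then show ?thesis using continuous_open_preimage[OF continuous_f open_domain, of "- {0}"] by (simp add: open_Compl)
qed

lemma nonzero: "x \<in> \<Omega> - \<Gamma> \<Longrightarrow> f x \<noteq> 0"
  by (simp add: zero_hypersurface_def)

lemma exp_branch: "x \<in> \<Omega> - \<Gamma> \<Longrightarrow> exp (l x) = complex_of_real (f x)"
  using branch by (simp add: log_branch_def)

text \<open>Near \<open>x\<close>, continuity forces \<open>l y - l x\<close> to be the principal logarithm of \<open>f y / f x\<close>.\<close>

lemma has_derivative_branch: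
  assumes x: "x \<in> \<Omega> - \<Gamma>"
  shows "(l has_derivative (\<lambda>h. complex_of_real (gradient f x \<bullet> h / f x))) (at x)"
proof -
  have fx: "f x \<noteq> 0" using nonzero[OF x] .
  have "isCont l x"
    using branch x open_complement by (simp add: log_branch_def continuous_on_eq_continuous_at)
  then have "((\<lambda>y. l y - l x) \<longlongrightarrow> 0) (at x)"
    by (simp add: isCont_def LIM_zero)
  then have ev: "\<forall>\<^sub>F y in at x. dist (l y - l x) 0 < pi"
    by (rule tendstoD) simp
  have "\<forall>\<^sub>F y in at x. y \<in> \<Omega> - \<Gamma>"
    using open_complement x by (rule eventually_at_in_open')
  with ev have eq: "\<forall>\<^sub>F y in at x. l x + Ln (complex_of_real (f y / f x)) = l y"
  proof eventually_elim
    case (elim y)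
    have "\<bar>Im (l y - l x)\<bar> < pi"
      using elim(1) abs_Im_le_cmod[of "l y - l x"] by simp
    then have "Ln (exp (l y - l x)) = l y - l x" by (intro Ln_exp) auto
    moreover have "exp (l y - l x) = complex_of_real (f y / f x)"
      using elim(2) x by (simp add: exp_diff exp_branch)
    ultimately show ?case by simp
  qed
  have "((\<lambda>y. complex_of_real (f y / f x)) has_derivative (\<lambda>h. complex_of_real (gradient f x \<bullet> h / f x))) (at x)"
    using has_derivative_gradient[OF diff_f] x
    by (intro bounded_linear.has_derivative[OF bounded_linear_of_real])
       (auto simp: divide_inverse intro!: has_derivative_mult_left)
  \<comment> \<open>The quotient \<open>f y / f x\<close> equals 1 at \<open>y = x\<close>, so the
    principal logarithm is differentiated away from its cut, whatever the sign of
    \<open>f x\<close>.\<close>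
  moreover have "(Ln has_derivative (*) 1) (at (complex_of_real (f x / f x)))"
    using has_field_derivative_Ln[of 1] fx by (simp add: has_field_derivative_def)
  ultimately have "((\<lambda>y. Ln (complex_of_real (f y / f x))) has_derivative
      (\<lambda>h. 1 * complex_of_real (gradient f x \<bullet> h / f x))) (at x)"
    by (rule has_derivative_compose)
  then have "((\<lambda>y. l x + Ln (complex_of_real (f y / f x))) has_derivative
      (\<lambda>h. complex_of_real (gradient f x \<bullet> h / f x))) (at x)"
    using has_derivative_add[OF has_derivative_const[of "l x"]] by force
  then show ?thesis
    by (rule has_derivative_transform_eventually[OF _ eq]) (use fx in auto)
qed

text \<open>The product rule, with the derivative of the power taken from that of \<open>l\<close>.
  Every term of the divergence carries the factor \<open>branch_power l (- r) x\<close>, so after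
  multiplication a real quantity remains, also where \<open>f\<close> is negative.\<close>

lemma scaled_divergence:
  assumes x: "x \<in> \<Omega> - \<Gamma>" and V: "V differentiable (at x)"
  shows "branch_power l r x * divergence (power_field l r V) x
    = complex_of_real (divergence V x - r * (lie_derivative V f x / f x))"
proof -
  let ?b = "branch_power l (- r)"
  have b: "(?b has_derivative (\<lambda>h. ?b x * complex_of_real (- r * (gradient f x \<bullet> h / f x)))) (at x)"
    unfolding branch_power_def
    by (rule has_derivative_eq_rhs, rule has_derivative_compose[OF has_derivative_mult_right[OF has_derivative_branch[OF x]]
          DERIV_exp[unfolded has_field_derivative_def]]) (simp add: fun_eq_iff)
  have "partial_deriv i (\<lambda>y. power_field l r V y $ i) x =
      ?b x * complex_of_real (partial_deriv i (\<lambda>y. V y $ i) x - r * (V x $ i * partial_deriv i f x / f x))" for i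
  proof -
    obtain D where D: "((\<lambda>y. V y $ i) has_derivative D) (at x)"
      using differentiable_component[OF V] by (auto simp: differentiable_def)
    have "((\<lambda>y. ?b y * complex_of_real (V y $ i)) has_derivative
       (\<lambda>h. ?b x * complex_of_real (D h) +
          ?b x * complex_of_real (- r * (gradient f x \<bullet> h / f x)) * complex_of_real (V x $ i))) (at x)"
      by (rule has_derivative_mult[OF b bounded_linear.has_derivative[OF bounded_linear_of_real D]])
    from partial_deriv_eq[OF this, of i] show ?thesis
      by (simp add: power_field_def complex_vec_def partial_deriv_eq[OF D] inner_axis gradient_def algebra_simps)
  qed
  then have "divergence (power_field l r V) x =
      ?b x * complex_of_real (divergence V x - r * (lie_derivative V f x / f x))"
    by (simp add: divergence_def lie_derivative_def sum_subtractf sum_distrib_left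
        right_diff_distrib sum_divide_distrib)
  then show ?thesis
    by (metis branch_power_mult_inverse mult.assoc mult_1)
qed

section \<open>Limits at the hypersurface: conditions (a) and (b)\<close>

text \<open>Otherwise \<open>f\<close> would vanish in a neighbourhood of \<open>p\<close> and its
  gradient at \<open>p\<close> would be zero. This makes limits from the complement unique.\<close>

lemma complement_limit_point:
  assumes p: "p \<in> \<Gamma>"
  shows "at p within (\<Omega> - \<Gamma>) \<noteq> bot"
proof
  assume "at p within (\<Omega> - \<Gamma>) = bot"
  then have "\<not> p islimpt (\<Omega> - \<Gamma>)" by (simp add: trivial_limit_within)
  then obtain T where T: "p \<in> T" "open T" "\<And>y. y \<in> \<Omega> - \<Gamma> \<Longrightarrow> y \<in> T \<Longrightarrow> y = p"
    by (auto simp: islimpt_def)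
  have p\<Omega>: "p \<in> \<Omega>" and fp: "f p = 0" using p by (auto simp: zero_hypersurface_def)
  have "\<forall>\<^sub>F y in at p. y \<in> T \<inter> \<Omega>"
    using T p\<Omega> open_domain by (intro eventually_at_in_open') auto
  then have zero: "\<forall>\<^sub>F y in at p. 0 = f y"
    by eventually_elim (use T(3) p in \<open>auto simp: zero_hypersurface_def\<close>)
  have "(f has_derivative (\<lambda>h. 0)) (at p)"
    by (rule has_derivative_transform_eventually[OF has_derivative_const zero]) (simp_all add: fp)
  then have "(\<lambda>h. gradient f p \<bullet> h) = (\<lambda>h. 0)"
    using has_derivative_gradient[OF diff_f[OF p\<Omega>]] by (rule has_derivative_unique[symmetric])
  then have "gradient f p \<bullet> gradient f p = 0" by (rule fun_cong)
  with regular[OF p] show False by simp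
qed

lemma continuous_lie_derivative:
  assumes "x \<in> \<Omega>" "V differentiable (at x)"
  shows "isCont (lie_derivative V f) x"
  unfolding lie_derivative_def
  using differentiable_imp_continuous_within[OF diff_partial_f[OF assms(1)]]
    differentiable_imp_continuous_within[OF assms(2)]
  by (intro continuous_intros) auto

text \<open>One more factor \<open>f\<close> clears the denominator: the expression in (a) becomes
  \<open>f x * divergence V x - r * lie_derivative V f x\<close>, which is continuous on all of
  \<open>\<Omega>\<close> and equals \<open>- r * lie_derivative V f p\<close> at a point
  \<open>p\<close> of \<open>\<Gamma>\<close>.\<close>

lemma condition_a_iff:
  assumes r: "r \<noteq> 0" and V: "\<And>x. x \<in> \<Omega> \<Longrightarrow> V differentiable (at x)"
    and div: "\<And>x. x \<in> \<Omega> \<Longrightarrow> isCont (divergence V) x"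
  shows "condition_a \<Omega> f l r V \<longleftrightarrow> invariant_hypersurface \<Omega> f V"
proof -
  have "((\<lambda>x. branch_power l (r + 1) x * divergence (power_field l r V) x) \<longlongrightarrow> 0)
        (at p within (\<Omega> - \<Gamma>)) \<longleftrightarrow> lie_derivative V f p = 0" if p: "p \<in> \<Gamma>" for p
  proof -
    have p\<Omega>: "p \<in> \<Omega>" and fp: "f p = 0" using p by (auto simp: zero_hypersurface_def)
    let ?g = "\<lambda>x. branch_power l (r + 1) x * divergence (power_field l r V) x"
    have eq: "complex_of_real (f x * divergence V x - r * lie_derivative V f x) = ?g x"
      if x: "x \<in> \<Omega> - \<Gamma>" for x
    proof -
      have "branch_power l (r + 1) x = complex_of_real (f x) * branch_power l r x"
        using exp_branch[OF x] by (simp add: branch_power_def distrib_right exp_add)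
      then have "?g x = complex_of_real (f x) * complex_of_real (divergence V x - r * (lie_derivative V f x / f x))"
        using scaled_divergence[OF x V, of r] x by (simp add: mult.assoc)
      then show ?thesis using nonzero[OF x] by (simp add: right_diff_distrib)
    qed
    have "isCont (\<lambda>x. complex_of_real (f x * divergence V x - r * lie_derivative V f x)) p"
      using differentiable_imp_continuous_within[OF diff_f[OF p\<Omega>]] div[OF p\<Omega>]
        continuous_lie_derivative[OF p\<Omega> V[OF p\<Omega>]]
      by (intro continuous_intros) auto
    then have "((\<lambda>x. complex_of_real (f x * divergence V x - r * lie_derivative V f x)) \<longlongrightarrow>
        complex_of_real (f p * divergence V p - r * lie_derivative V f p)) (at p within (\<Omega> - \<Gamma>))"
      by (simp only: isCont_def) (rule tendsto_within_subset, auto)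
    then have "((\<lambda>x. complex_of_real (f x * divergence V x - r * lie_derivative V f x)) \<longlongrightarrow>
        complex_of_real (- r * lie_derivative V f p)) (at p within (\<Omega> - \<Gamma>))"
      by (simp add: fp)
    then have lim: "(?g \<longlongrightarrow> complex_of_real (- r * lie_derivative V f p)) (at p within (\<Omega> - \<Gamma>))"
      by (rule tendsto_cong[THEN iffD1, rotated])
        (use eq in \<open>auto simp: eventually_at_filter\<close>)
    show ?thesis
      using lim tendsto_unique[OF complement_limit_point[OF p] _ lim, of 0] r by auto
  qed
  then show ?thesis by (simp add: condition_a_def invariant_hypersurface_def)
qed

text \<open>Off \<open>\<Gamma>\<close> the identity says that the Lie derivative vanishes, and
  continuity carries this to \<open>\<Gamma>\<close>. The second conjunct expresses the extension of
  the left side by continuity.\<close>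

lemma first_integral_iff:
  assumes r: "r \<noteq> 0" and V: "\<And>x. x \<in> \<Omega> \<Longrightarrow> V differentiable (at x)"
    and div: "\<And>x. x \<in> \<Omega> \<Longrightarrow> isCont (divergence V) x"
  shows "first_integral \<Omega> f V \<longleftrightarrow>
    (\<forall>x\<in>\<Omega> - \<Gamma>. branch_power l r x * divergence (power_field l r V) x = complex_of_real (divergence V x)) \<and>
    (\<forall>p\<in>\<Gamma>. ((\<lambda>x. branch_power l r x * divergence (power_field l r V) x)
       \<longlongrightarrow> complex_of_real (divergence V p)) (at p within (\<Omega> - \<Gamma>)))"
    (is "_ \<longleftrightarrow> ?A \<and> ?B")
proof -
  have A: "?A \<longleftrightarrow> (\<forall>x\<in>\<Omega> - \<Gamma>. lie_derivative V f x = 0)"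
  proof (rule ball_cong[OF refl])
    fix x assume x: "x \<in> \<Omega> - \<Gamma>"
    then have "branch_power l r x * divergence (power_field l r V) x
      = complex_of_real (divergence V x - r * (lie_derivative V f x / f x))"
      by (intro scaled_divergence V) auto
    then show "(branch_power l r x * divergence (power_field l r V) x = complex_of_real (divergence V x))
      \<longleftrightarrow> lie_derivative V f x = 0"
      using nonzero[OF x] r by (simp del: of_real_diff)
  qed
  have "lie_derivative V f p = 0" if "\<forall>x\<in>\<Omega> - \<Gamma>. lie_derivative V f x = 0" "p \<in> \<Gamma>" for p
  proof -
    have p\<Omega>: "p \<in> \<Omega>" using that by (auto simp: zero_hypersurface_def)
    have "(lie_derivative V f \<longlongrightarrow> lie_derivative V f p) (at p within (\<Omega> - \<Gamma>))"
      using continuous_lie_derivative[OF p\<Omega> V[OF p\<Omega>]] unfolding isCont_def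
      by (rule tendsto_within_subset) auto
    moreover have "(lie_derivative V f \<longlongrightarrow> 0) (at p within (\<Omega> - \<Gamma>))"
      using that by (intro tendsto_eventually) (auto simp: eventually_at_filter)
    ultimately show ?thesis
      using complement_limit_point[OF that(2)] tendsto_unique by blast
  qed
  then have "first_integral \<Omega> f V \<longleftrightarrow> ?A"
    unfolding A first_integral_def by (auto simp: zero_hypersurface_def)
  moreover have ?B if ?A
  proof
    fix p assume "p \<in> \<Gamma>"
    then have "isCont (divergence V) p" by (intro div) (auto simp: zero_hypersurface_def)
    then have "(divergence V \<longlongrightarrow> divergence V p) (at p within (\<Omega> - \<Gamma>))"
      unfolding isCont_def by (rule tendsto_within_subset) auto
    then have "((\<lambda>x. complex_of_real (divergence V x)) \<longlongrightarrow> complex_of_real (divergence V p)) (at p within (\<Omega> - \<Gamma>))"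
      by (rule tendsto_of_real)
    then show "((\<lambda>x. branch_power l r x * divergence (power_field l r V) x)
       \<longlongrightarrow> complex_of_real (divergence V p)) (at p within (\<Omega> - \<Gamma>))"
      by (rule tendsto_cong[THEN iffD1, rotated]) (use that in \<open>auto simp: eventually_at_filter\<close>)
  qed
  ultimately show ?thesis by blast
qed

text \<open>Rewrites the first limit in (b) as a real one, from which the limit of
  \<open>lie_derivative V f x / f x\<close> can be extracted.\<close>

lemma condition_b_limit:
  assumes b: "condition_b \<Omega> f l r V" and p: "p \<in> \<Gamma>" "V p = 0"
    and V: "\<And>x. x \<in> \<Omega> \<Longrightarrow> V differentiable (at x)"
  shows "((\<lambda>x. divergence V x - r * (lie_derivative V f x / f x)) \<longlongrightarrow> 0) (at p within (\<Omega> - \<Gamma>))"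
proof -
  have "((\<lambda>x. branch_power l r x * divergence (power_field l r V) x) \<longlongrightarrow> 0) (at p within (\<Omega> - \<Gamma>))"
    using b p by (auto simp: condition_b_def)
  then have "((\<lambda>x. complex_of_real (divergence V x - r * (lie_derivative V f x / f x))) \<longlongrightarrow> 0) (at p within (\<Omega> - \<Gamma>))"
    by (rule tendsto_cong[THEN iffD1, rotated])
      (use scaled_divergence V in \<open>auto simp: eventually_at_filter\<close>)
  then show ?thesis
    by (simp only: tendsto_of_real_iff[where c = 0, simplified])
qed

text \<open>Since \<open>L\<^sub>V f - \<mu> f\<close> is \<open>o(f)\<close>, its derivative at \<open>p\<close> vanishes.\<close>

lemma gradient_left_eigenvector:
  assumes p: "p \<in> \<Gamma>" "V p = 0" and D: "(V has_derivative D) (at p)"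
    and inv: "invariant_hypersurface \<Omega> f V"
    and lim: "((\<lambda>x. lie_derivative V f x / f x) \<longlongrightarrow> \<mu>) (at p within (\<Omega> - \<Gamma>))"
  shows "gradient f p \<bullet> D h = \<mu> * (gradient f p \<bullet> h)"
proof -
  let ?g = "\<lambda>x. lie_derivative V f x - \<mu> * f x"
  have p\<Omega>: "p \<in> \<Omega>" and fp: "f p = 0" using p by (auto simp: zero_hypersurface_def)
  have f: "(f has_derivative (\<lambda>h. gradient f p \<bullet> h)) (at p)"
    by (rule has_derivative_gradient[OF diff_f[OF p\<Omega>]])
  \<comment> \<open>The product-rule term with second derivatives of \<open>f\<close> carries the
    factor \<open>V p $ i\<close>, which is zero.\<close>
  have "((\<lambda>x. V x $ i * partial_deriv i f x) has_derivative (\<lambda>h. D h $ i * partial_deriv i f p)) (at p)" for i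
  proof -
    obtain E where E: "(partial_deriv i f has_derivative E) (at p)"
      using diff_partial_f[OF p\<Omega>] by (auto simp: differentiable_def)
    show ?thesis
      using has_derivative_mult[OF bounded_linear.has_derivative[OF bounded_linear_vec_nth D] E, of i] p(2)
      by simp
  qed
  then have "(lie_derivative V f has_derivative (\<lambda>h. \<Sum>i\<in>UNIV. D h $ i * partial_deriv i f p)) (at p)"
    unfolding lie_derivative_def by (intro has_derivative_sum)
  moreover have "(\<Sum>i\<in>UNIV. D h $ i * partial_deriv i f p) = gradient f p \<bullet> D h" for h
    by (simp add: gradient_def inner_vec_def mult.commute)
  ultimately have g1: "(?g has_derivative (\<lambda>h. gradient f p \<bullet> D h - \<mu> * (gradient f p \<bullet> h))) (at p)"
    using f by (auto intro!: derivative_eq_intros)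
  \<comment> \<open>With the value 0 on \<open>\<Gamma>\<close>, the factorization
    \<open>?g x = f x * q x\<close> holds on all of \<open>\<Omega>\<close>: invariance makes both
    sides vanish there. The limit of \<open>q\<close> at \<open>p\<close> then holds without
    restriction to the complement.\<close>
  define q where "q x = (if x \<in> \<Omega> - \<Gamma> then lie_derivative V f x / f x - \<mu> else 0)" for x
  have gq: "?g x = f x * q x" if "x \<in> \<Omega>" for x
    using that inv nonzero[of x] by (auto simp: q_def invariant_hypersurface_def zero_hypersurface_def field_simps)
  have "((\<lambda>x. lie_derivative V f x / f x - \<mu>) \<longlongrightarrow> 0) (at p within (\<Omega> - \<Gamma>))"
    using lim by (rule LIM_zero)
  then have q: "(q \<longlongrightarrow> 0) (at p)"
    unfolding tendsto_iff q_def by (auto simp: eventually_at_filter elim!: eventually_mono)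
  obtain d where d: "d > 0" "\<And>y. norm (y - p) < d \<Longrightarrow> norm (f y - f p - gradient f p \<bullet> (y - p)) \<le> 1 * norm (y - p)"
    using f unfolding has_derivative_at_alt by (metis zero_less_one)
  obtain d' where d': "d' > 0" "ball p d' \<subseteq> \<Omega>"
    using open_domain p\<Omega> openE by blast
  \<comment> \<open>Differentiability of \<open>f\<close> with tolerance 1 yields
    \<open>\<bar>f y\<bar> \<le> ?K * norm (y - p)\<close> near \<open>p\<close>; as
    \<open>q\<close> tends to 0, the product \<open>f y * q y\<close> is of smaller order than
    \<open>norm (y - p)\<close>.\<close>
  let ?K = "1 + norm (gradient f p)"
  have lip: "\<bar>f y\<bar> \<le> ?K * norm (y - p)" if "norm (y - p) < d" for y
  proof -
    have "\<bar>f y\<bar> \<le> norm (y - p) + \<bar>gradient f p \<bullet> (y - p)\<bar>"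
      using d(2)[OF that] fp by simp
    also have "\<dots> \<le> ?K * norm (y - p)"
      using Cauchy_Schwarz_ineq2[of "gradient f p" "y - p"] by (simp add: algebra_simps)
    finally show ?thesis .
  qed
  have "(?g has_derivative (\<lambda>h. 0)) (at p)"
  proof (rule has_derivativeI_sandwich[of "min d d'" _ _ _ _ "\<lambda>y. ?K * \<bar>q y\<bar>"])
    show "0 < min d d'" using d d' by simp
    show "((\<lambda>y. ?K * \<bar>q y\<bar>) \<longlongrightarrow> 0) (at p)"
      using tendsto_mult_right_zero[OF tendsto_rabs_zero[OF q]] .
    fix y assume y: "y \<noteq> p" "dist y p < min d d'"
    then have "y \<in> \<Omega>" using d'(2) by (auto simp: dist_commute)
    have "norm (?g y - ?g p - 0) = \<bar>f y\<bar> * \<bar>q y\<bar>"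
      using gq[OF p\<Omega>] gq[OF \<open>y \<in> \<Omega>\<close>] fp by (simp add: abs_mult)
    also have "\<dots> \<le> ?K * norm (y - p) * \<bar>q y\<bar>"
      using y lip[of y] by (intro mult_right_mono) (auto simp: dist_norm)
    finally show "norm (?g y - ?g p - 0) / norm (y - p) \<le> ?K * \<bar>q y\<bar>"
      using y by (simp add: divide_le_eq mult.commute mult.left_commute)
  qed simp
  then have "(\<lambda>h. gradient f p \<bullet> D h - \<mu> * (gradient f p \<bullet> h)) = (\<lambda>h. 0)"
    using g1 has_derivative_unique by blast
  then show ?thesis by (metis eq_iff_diff_eq_0)
qed

section \<open>The restricted field in local coordinates\<close>

text \<open>Since \<open>f\<close> vanishes along \<open>\<sigma>\<close>, the chain rule puts the
  range of \<open>D\<close> into the tangent hyperplane; injectivity makes the dimensions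
  equal.\<close>

lemma range_parametrization_derivative:
  fixes \<sigma> :: "real^'m::finite \<Rightarrow> real^'n"
  assumes card: "CARD('m) + 1 = CARD('n)"
    and U: "open U" "u \<in> U" "\<sigma> ` U \<subseteq> \<Gamma>"
    and D: "(\<sigma> has_derivative D) (at u)" "inj D"
  shows "range D = {h. gradient f (\<sigma> u) \<bullet> h = 0}"
proof -
  let ?w = "gradient f (\<sigma> u)"
  have \<sigma>u: "\<sigma> u \<in> \<Gamma>" "\<sigma> u \<in> \<Omega>" using U by (auto simp: zero_hypersurface_def)
  have lin: "linear D" using D(1) by (rule has_derivative_linear)
  have "((\<lambda>y. f (\<sigma> y)) has_derivative (\<lambda>h. ?w \<bullet> D h)) (at u)"
    by (rule has_derivative_compose[OF D(1) has_derivative_gradient[OF diff_f[OF \<sigma>u(2)]]])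
  moreover have "\<forall>\<^sub>F y in at u. 0 = f (\<sigma> y)"
    using eventually_at_in_open'[OF U(1,2)]
    by eventually_elim (use U(3) in \<open>auto simp: zero_hypersurface_def\<close>)
  then have "((\<lambda>y. f (\<sigma> y)) has_derivative (\<lambda>h. 0)) (at u)"
    by (rule has_derivative_transform_eventually[OF has_derivative_const])
      (use \<sigma>u in \<open>auto simp: zero_hypersurface_def\<close>)
  ultimately have zero: "?w \<bullet> D h = 0" for h
    using has_derivative_unique by (metis (no_types, lifting))
  have "dim (range D) = CARD('m)"
    using D(2) by (subst dim_image_eq[OF lin]) (simp_all add: inj_on_subset)
  then show ?thesis
    using zero card regular[OF \<sigma>u(1)]
    by (intro subspace_dim_equal) (auto simp: dim_hyperplane subspace_hyperplane linear_subspace_image[OF lin])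
qed

text \<open>The coordinate field vanishes at \<open>u\<close>, so differentiating its defining
  equation there leaves \<open>T u (C *v h) = A *v T u h\<close>. Its linearization is thus the
  compression of \<open>A\<close> to the tangent hyperplane.\<close>

lemma eigenvalues_coordinate_field:
  fixes \<sigma> :: "real^'m::finite \<Rightarrow> real^'n" and A :: "real^'n^'n"
  assumes card: "CARD('m) + 1 = CARD('n)"
    and param: "local_parametrization s \<Gamma> U \<sigma>" "s \<ge> 2" and u: "u \<in> U" "\<sigma> u = p"
    and X: "(X has_derivative (*v) A) (at p)" "X p = 0"
    and inv: "invariant_hypersurface \<Omega> f X"
    and left: "\<And>h. gradient f p \<bullet> (A *v h) = \<mu> * (gradient f p \<bullet> h)"
  shows "eigenvalues A = add_mset (complex_of_real \<mu>) (eigenvalues (jacobian (coordinate_field \<sigma> X) (at u)))"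
proof -
  define T where "T v = frechet_derivative \<sigma> (at v)" for v
  have U: "open U" "\<sigma> ` U \<subseteq> \<Gamma>" and C: "C_k_on s \<sigma> U" and inj: "\<And>v. v \<in> U \<Longrightarrow> inj (T v)"
    using param by (auto simp: local_parametrization_def T_def dest: openin_imp_subset)
  have T: "(\<sigma> has_derivative T v) (at v)" if "v \<in> U" for v
    using C_k_on_differentiable[OF C _ U(1) that] param(2) by (simp add: T_def frechet_derivative_works)
  have lin: "linear (T v)" if "v \<in> U" for v
    using T[OF that] by (rule has_derivative_linear)
  have range: "range (T v) = {h. gradient f (\<sigma> v) \<bullet> h = 0}" if "v \<in> U" for v
    by (rule range_parametrization_derivative[OF card U(1) that U(2) T[OF that] inj[OF that]])
  have w: "gradient f p \<noteq> 0" using u U by (intro regular) auto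
  have range_u: "range (T u) = {h. gradient f p \<bullet> h = 0}" using range[OF u(1)] u(2) by simp
  obtain C where AC: "\<And>h. A *v T u h = T u (C *v h)"
    and eig: "eigenvalues A = add_mset (complex_of_real \<mu>) (eigenvalues C)"
    using hyperplane_compression[OF card w left lin[OF u(1)] inj[OF u(1)] range_u] by blast
  let ?Y = "coordinate_field \<sigma> X"
  \<comment> \<open>Invariance makes \<open>X (\<sigma> v)\<close> tangent, hence in the range of
    \<open>T v\<close>; with injectivity the definite description in \<open>coordinate_field\<close>
    has a unique value.\<close>
  have Y: "T v (?Y v) = X (\<sigma> v)" if v: "v \<in> U" for v
  proof -
    have "\<sigma> v \<in> \<Gamma>" using U v by auto
    then have "X (\<sigma> v) \<in> range (T v)"
      using inv by (simp add: range[OF v] invariant_hypersurface_def lie_derivative_gradient)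
    then have "\<exists>!\<xi>. T v \<xi> = X (\<sigma> v)" using inj_eq[OF inj[OF v]] by (auto simp del: inj_eq)
    from theI'[OF this] show ?thesis by (simp add: coordinate_field_def T_def)
  qed
  have Y0: "?Y u = 0"
    using Y[OF u(1)] X(2) u linear_0[OF lin[OF u(1)]] inj[OF u(1)] by (metis injD)
  \<comment> \<open>Extended by zero outside \<open>U\<close>, so that \<open>S v\<close> is linear
    for every \<open>v\<close>.\<close>
  define S where "S v \<xi> = (if v \<in> U then T v \<xi> else 0)" for v \<xi>
  obtain k where k: "k > 0" "\<And>\<xi>. k * norm \<xi> \<le> norm (T u \<xi>)"
    using linear_inj_bounded_below_pos[OF lin[OF u(1)] inj[OF u(1)]] by metis
  have "(?Y has_derivative (*v) C) (at u)"
  proof (rule has_derivative_solution[where T = S and c = k and F = "\<lambda>v. X (\<sigma> v)" and F' = "\<lambda>h. A *v (T u h)"])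
    show "linear (S v)" for v
      using lin[of v] by (cases "v \<in> U") (simp_all add: S_def[abs_def] linear_zero)
    show "((\<lambda>v. X (\<sigma> v)) has_derivative (\<lambda>h. A *v (T u h))) (at u)"
      by (rule has_derivative_compose[OF T[OF u(1)]]) (use X(1) u in simp)
    show "\<forall>\<^sub>F v in at u. S v (?Y v) = X (\<sigma> v)"
      using eventually_at_in_open'[OF U(1) u(1)] by eventually_elim (simp add: S_def Y)
    show "S u (C *v h) = A *v (T u h)" for h
      using u(1) by (simp add: S_def AC)
    fix \<eta> :: real assume "\<eta> > 0"
    \<comment> \<open>This sum bounds the operator norm of \<open>T v - T u\<close>; it tends to 0
      because the first partial derivatives of \<open>\<sigma>\<close> are continuous.\<close>
    let ?e = "\<lambda>v. \<Sum>i\<in>UNIV. norm (partial_deriv i \<sigma> v - partial_deriv i \<sigma> u)"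
    have "isCont (partial_deriv i \<sigma>) u" for i
      using C_k_on_partial_deriv_differentiable[OF \<open>C_k_on s \<sigma> U\<close> param(2) U(1) u(1)]
      by (rule differentiable_imp_continuous_within)
    then have "isCont ?e u" by (intro continuous_intros)
    then have "(?e \<longlongrightarrow> 0) (at u)" by (simp add: isCont_def)
    then have "\<forall>\<^sub>F v in at u. ?e v < \<eta>" using \<open>\<eta> > 0\<close> by (rule order_tendstoD)
    with eventually_at_in_open'[OF U(1) u(1)]
    show "\<forall>\<^sub>F v in at u. \<forall>\<xi>. norm (S v \<xi> - S u \<xi>) \<le> \<eta> * norm \<xi>"
    proof eventually_elim
      case (elim v)
      show ?case
      proof
        fix \<xi> :: "real^'m"
        have "S v \<xi> - S u \<xi> = (\<Sum>i\<in>UNIV. (\<xi> $ i) *\<^sub>R (partial_deriv i \<sigma> v - partial_deriv i \<sigma> u))"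
          using elim(1) u(1)
          by (simp add: S_def has_derivative_partial_deriv[OF T] scaleR_diff_right sum_subtractf)
        also have "norm \<dots> \<le> (\<Sum>i\<in>UNIV. norm \<xi> * norm (partial_deriv i \<sigma> v - partial_deriv i \<sigma> u))"
          by (rule sum_norm_le) (simp add: mult_right_mono component_le_norm_cart)
        also have "\<dots> = norm \<xi> * ?e v" by (simp add: sum_distrib_left)
        also have "\<dots> \<le> \<eta> * norm \<xi>"
          using elim(2) by (subst mult.commute) (intro mult_right_mono, auto)
        finally show "norm (S v \<xi> - S u \<xi>) \<le> \<eta> * norm \<xi>" .
      qed
    qed
  qed (use k u X Y0 in \<open>auto simp: S_def\<close>)
  then have "jacobian ?Y (at u) = C"
    by (simp add: jacobian_def frechet_derivative_at[symmetric] matrix_of_matrix_vector_mul)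
  with eig show ?thesis by simp
qed

end

text \<open>The type \<open>'m\<close> carries the coordinates of the hypersurface. The function
  \<open>ev\<close> enumerates the spectrum with multiplicity, so that dropping the index
  \<open>j\<close> removes a single entry. A transversal eigenvector is asserted when
  \<open>ev j\<close> is simple, and a generalized one in every case, because a defective
  \<open>ev j\<close> may have only tangent eigenvectors.\<close>

theorem theorem3:
  fixes \<Omega> :: "(real^'n::finite) set"
    and f \<phi> :: "real^'n \<Rightarrow> real"
    and V :: "real^'n \<Rightarrow> real^'n"
    and r :: real
    and s :: nat
    and l :: "real^'n \<Rightarrow> complex"
  defines "\<Gamma> \<equiv> zero_hypersurface \<Omega> f"
    and "\<phi>V \<equiv> \<lambda>x. \<phi> x *\<^sub>R V x"
  assumes "CARD('n) \<ge> 2"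
    and "CARD('m::finite) + 1 = CARD('n)"
    and "open \<Omega>" and "connected \<Omega>" and "\<Omega> \<noteq> {}"
    and "s \<ge> 2"
    and "C_k_on s f \<Omega>" and "C_k_on s V \<Omega>" and "C_k_on s \<phi> \<Omega>"
    and "\<forall>x\<in>\<Gamma>. gradient f x \<noteq> 0"
    and "\<forall>x\<in>\<Omega>. \<phi> x \<noteq> 0"
    and "r > 0"
    and "log_branch \<Omega> f l"
  shows "((condition_a \<Omega> f l r V \<longleftrightarrow> invariant_hypersurface \<Omega> f \<phi>V) \<and>
      (first_integral \<Omega> f \<phi>V \<longleftrightarrow>
         (\<forall>x\<in>\<Omega> - \<Gamma>. branch_power l r x * divergence (power_field l r \<phi>V) x
                      = complex_of_real (divergence \<phi>V x)) \<and>
         (\<forall>p\<in>\<Gamma>. ((\<lambda>x. branch_power l r x * divergence (power_field l r \<phi>V) x)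
                      \<longlongrightarrow> complex_of_real (divergence \<phi>V p)) (at p within (\<Omega> - \<Gamma>)))) \<and>
      (first_integral \<Omega> f \<phi>V \<and> condition_b \<Omega> f l r V \<longrightarrow>
         (\<forall>p\<in>\<Gamma>. V p = 0 \<longrightarrow> divergence \<phi>V p = 0)))
    \<and>
    (\<forall>p\<in>\<Gamma>. \<forall>ev :: 'n \<Rightarrow> complex.
      \<phi>V p = 0 \<and> eigenvalues (jacobian \<phi>V (at p)) = image_mset ev (mset_set UNIV) \<and>
      condition_a \<Omega> f l r V \<and> condition_b \<Omega> f l r V \<longrightarrow>
      (\<exists>j. (\<Sum>i\<in>UNIV. ev i) = complex_of_real r * ev j \<and>
         (\<exists>v. generalized_eigenvector (complex_mat (jacobian \<phi>V (at p))) (ev j) (complex_vec v) \<and>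
              transversal_at f p v) \<and>
         ((\<forall>i. i \<noteq> j \<longrightarrow> ev i \<noteq> ev j) \<longrightarrow>
            (\<exists>v. eigenvector (complex_mat (jacobian \<phi>V (at p))) (ev j) (complex_vec v) \<and>
                 transversal_at f p v)) \<and>
         (\<forall>(U :: (real^'m) set) \<sigma> u.
            local_parametrization s \<Gamma> U \<sigma> \<and> u \<in> U \<and> \<sigma> u = p \<longrightarrow>
            eigenvalues (jacobian (coordinate_field \<sigma> \<phi>V) (at u))
              = image_mset ev (mset_set (UNIV - {j}))) \<and>
         (first_integral \<Omega> f \<phi>V \<longrightarrow> ev j = 0)))"
proof -
  have \<Gamma>_sub: "x \<in> \<Omega>" if "x \<in> \<Gamma>" for x using that by (simp add: \<Gamma>_def zero_hypersurface_def)
  note open\<Omega> = \<open>open \<Omega>\<close> and s2 = \<open>s \<ge> 2\<close>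
  interpret regular_log_branch \<Omega> f l
    using assms C_k_on_differentiable[of s f \<Omega>] C_k_on_partial_deriv_differentiable[of s f \<Omega>]
    by unfold_locales auto
  note at_nontrivial = complement_limit_point[folded \<Gamma>_def]
    and left_eigenvector = gradient_left_eigenvector[folded \<Gamma>_def]
    and coordinate_spectrum = eigenvalues_coordinate_field[folded \<Gamma>_def]
  have diffV: "V differentiable (at x)" and diff\<phi>: "\<phi> differentiable (at x)" if "x \<in> \<Omega>" for x
    using C_k_on_differentiable[of s _ \<Omega>] assms that by auto
  have r: "r \<noteq> 0" using \<open>r > 0\<close> by simp
  have cont_partial: "isCont (partial_deriv i g) x"
    if "C_k_on s g \<Omega>" "x \<in> \<Omega>" for g :: "real^'n \<Rightarrow> 'b::real_normed_vector" and i x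
    using C_k_on_partial_deriv_differentiable[OF that(1) s2 open\<Omega> that(2)]
    by (rule differentiable_imp_continuous_within)
  have diff\<phi>V: "\<phi>V differentiable (at x)" if "x \<in> \<Omega>" for x
    using diffV[OF that] diff\<phi>[OF that] by (simp add: \<phi>V_def)
  have lie: "lie_derivative \<phi>V f x = \<phi> x * lie_derivative V f x" for x
    by (simp add: lie_derivative_gradient \<phi>V_def)
  have div: "divergence \<phi>V x = \<phi> x * divergence V x + lie_derivative V \<phi> x" if x: "x \<in> \<Omega>" for x
  proof -
    have "partial_deriv i (\<lambda>y. \<phi>V y $ i) x =
        \<phi> x * partial_deriv i (\<lambda>y. V y $ i) x + V x $ i * partial_deriv i \<phi> x" for i
    proof -
      obtain D E where D: "((\<lambda>y. V y $ i) has_derivative D) (at x)" and E: "(\<phi> has_derivative E) (at x)"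
        using differentiable_component[OF diffV[OF x]] diff\<phi>[OF x] unfolding differentiable_def by blast
      show ?thesis
        using partial_deriv_eq[OF has_derivative_mult[OF E D], of i]
        by (simp add: \<phi>V_def partial_deriv_eq[OF D] partial_deriv_eq[OF E] mult.commute)
    qed
    then show ?thesis by (simp add: divergence_def lie_derivative_def sum.distrib sum_distrib_left)
  qed
  have cont_divV: "isCont (divergence V) x" if x: "x \<in> \<Omega>" for x
  proof -
    have "\<forall>\<^sub>F y in nhds x. divergence V y = (\<Sum>i\<in>UNIV. partial_deriv i V y $ i)"
      using eventually_nhds_in_open[OF open\<Omega> x]
      by eventually_elim (simp add: divergence_def partial_deriv_component[OF diffV])
    moreover have "isCont (\<lambda>y. \<Sum>i\<in>UNIV. partial_deriv i V y $ i) x"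
      using cont_partial[OF \<open>C_k_on s V \<Omega>\<close> x] by (intro continuous_intros)
    ultimately show ?thesis by (simp add: isCont_cong)
  qed
  have cont_div: "isCont (divergence \<phi>V) x" if x: "x \<in> \<Omega>" for x
  proof -
    have "\<forall>\<^sub>F y in nhds x. divergence \<phi>V y = \<phi> y * divergence V y + (\<Sum>i\<in>UNIV. V y $ i * partial_deriv i \<phi> y)"
      using eventually_nhds_in_open[OF open\<Omega> x]
      by eventually_elim (simp add: div lie_derivative_def)
    moreover have "isCont (\<lambda>y. \<phi> y * divergence V y + (\<Sum>i\<in>UNIV. V y $ i * partial_deriv i \<phi> y)) x"
      using cont_partial[OF \<open>C_k_on s \<phi> \<Omega>\<close> x] cont_divV[OF x]
        differentiable_imp_continuous_within[OF diff\<phi>[OF x]] differentiable_imp_continuous_within[OF diffV[OF x]]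
      by (intro continuous_intros)
    ultimately show ?thesis by (simp add: isCont_cong)
  qed
  have b_limit: "((\<lambda>x. divergence V x - r * (lie_derivative V f x / f x)) \<longlongrightarrow> 0) (at p within (\<Omega> - \<Gamma>))"
    if "condition_b \<Omega> f l r V" "p \<in> \<Gamma>" "V p = 0" for p
    by (rule condition_b_limit[folded \<Gamma>_def, OF that diffV])
  have \<phi>0: "\<phi> x \<noteq> 0" if "x \<in> \<Omega>" for x using that assms by auto
  have inv_iff: "invariant_hypersurface \<Omega> f \<phi>V \<longleftrightarrow> invariant_hypersurface \<Omega> f V"
    using \<phi>0 \<Gamma>_sub unfolding \<Gamma>_def invariant_hypersurface_def lie by auto
  \<comment> \<open>Condition (a) concerns \<open>V\<close> and invariance concerns
    \<open>\<phi>V\<close>; the two Lie derivatives differ by the nonvanishing factor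
    \<open>\<phi>\<close>.\<close>
  have a: "condition_a \<Omega> f l r V \<longleftrightarrow> invariant_hypersurface \<Omega> f \<phi>V"
    using condition_a_iff[OF r diffV cont_divV] inv_iff by simp
  \<comment> \<open>The Lie derivative of \<open>f\<close> along \<open>V\<close> vanishes, so (b)
    forces \<open>divergence V p = 0\<close>. At a zero of \<open>V\<close> the extra term
    \<open>lie_derivative V \<phi> p\<close> vanishes too.\<close>
  have fi: "divergence \<phi>V p = 0"
    if h: "first_integral \<Omega> f \<phi>V" "condition_b \<Omega> f l r V" and p: "p \<in> \<Gamma>" "V p = 0" for p
  proof -
    have "lie_derivative V f x = 0" if "x \<in> \<Omega>" for x
      using h(1) \<phi>0 that by (auto simp: first_integral_def lie)
    then have "\<forall>\<^sub>F x in at p within (\<Omega> - \<Gamma>). divergence V x - r * (lie_derivative V f x / f x) = divergence V x"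
      by (auto simp: eventually_at_filter)
    then have "(divergence V \<longlongrightarrow> 0) (at p within (\<Omega> - \<Gamma>))"
      using b_limit[OF h(2) p] by (rule tendsto_cong[THEN iffD1])
    moreover have "(divergence V \<longlongrightarrow> divergence V p) (at p within (\<Omega> - \<Gamma>))"
      using cont_divV[OF \<Gamma>_sub[OF p(1)]] unfolding isCont_def by (rule tendsto_within_subset) auto
    ultimately have "divergence V p = 0"
      using at_nontrivial[OF p(1)] tendsto_unique by blast
    with p show ?thesis by (simp add: div[OF \<Gamma>_sub] lie_derivative_gradient)
  qed
  have spectral: "\<exists>j. (\<Sum>i\<in>UNIV. ev i) = complex_of_real r * ev j \<and>
         (\<exists>v. generalized_eigenvector (complex_mat (jacobian \<phi>V (at p))) (ev j) (complex_vec v) \<and>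
              transversal_at f p v) \<and>
         ((\<forall>i. i \<noteq> j \<longrightarrow> ev i \<noteq> ev j) \<longrightarrow>
            (\<exists>v. eigenvector (complex_mat (jacobian \<phi>V (at p))) (ev j) (complex_vec v) \<and>
                 transversal_at f p v)) \<and>
         (\<forall>(U :: (real^'m) set) \<sigma> u.
            local_parametrization s \<Gamma> U \<sigma> \<and> u \<in> U \<and> \<sigma> u = p \<longrightarrow>
            eigenvalues (jacobian (coordinate_field \<sigma> \<phi>V) (at u))
              = image_mset ev (mset_set (UNIV - {j}))) \<and>
         (first_integral \<Omega> f \<phi>V \<longrightarrow> ev j = 0)"
    if p: "p \<in> \<Gamma>" and X0: "\<phi>V p = 0"
      and ev: "eigenvalues (jacobian \<phi>V (at p)) = image_mset ev (mset_set UNIV)"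
      and ca: "condition_a \<Omega> f l r V" and cb: "condition_b \<Omega> f l r V" for p and ev :: "'n \<Rightarrow> complex"
  proof -
    let ?A = "jacobian \<phi>V (at p)" and ?w = "gradient f p"
    have p\<Omega>: "p \<in> \<Omega>" using \<Gamma>_sub[OF p] .
    have V0: "V p = 0" using X0 \<phi>0[OF p\<Omega>] by (simp add: \<phi>V_def)
    have w: "?w \<noteq> 0" using p assms by auto
    have inv: "invariant_hypersurface \<Omega> f \<phi>V" using a ca by simp
    have A: "(\<phi>V has_derivative (*v) ?A) (at p)"
      using diff\<phi>V[OF p\<Omega>] by (simp add: jacobian_works)
    \<comment> \<open>Chosen so that the trace identity holds by construction; it remains to show
      that this number is the eigenvalue in the direction transversal to
      \<open>\<Gamma>\<close>.\<close>
    define \<mu> where "\<mu> = trace ?A / r"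
    have \<mu>: "\<mu> = \<phi> p * divergence V p / r"
      using V0 by (simp add: \<mu>_def div[OF p\<Omega>] lie_derivative_gradient flip: divergence_eq_trace[OF diff\<phi>V[OF p\<Omega>]])
    have lim: "((\<lambda>x. lie_derivative \<phi>V f x / f x) \<longlongrightarrow> \<mu>) (at p within (\<Omega> - \<Gamma>))"
    proof -
      have "isCont \<phi> p" "isCont (divergence V) p"
        using differentiable_imp_continuous_within[OF diff\<phi>[OF p\<Omega>]] cont_divV[OF p\<Omega>] by auto
      then have "(\<phi> \<longlongrightarrow> \<phi> p) (at p within (\<Omega> - \<Gamma>))"
        "(divergence V \<longlongrightarrow> divergence V p) (at p within (\<Omega> - \<Gamma>))"
        unfolding isCont_def by (auto elim: tendsto_within_subset)
      \<comment> \<open>The quotient \<open>lie_derivative V f x / f x\<close> is recovered as the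
        difference between the divergence and the expression whose limit is known, divided by
        \<open>r\<close>.\<close>
      then have "((\<lambda>x. \<phi> x * ((divergence V x - (divergence V x - r * (lie_derivative V f x / f x))) / r))
          \<longlongrightarrow> \<phi> p * ((divergence V p - 0) / r)) (at p within (\<Omega> - \<Gamma>))"
        using b_limit[OF cb p V0] r by (intro tendsto_intros)
      then show ?thesis using r by (simp add: lie \<mu>)
    qed
    have left: "?w \<bullet> (?A *v h) = \<mu> * (?w \<bullet> h)" for h
      using left_eigenvector[OF p X0 A inv lim] .
    obtain D :: "real^'m \<Rightarrow> real^'n" where D: "linear D" "inj D" "range D = {h. ?w \<bullet> h = 0}"
      using hyperplane_parametrization[OF assms(4) w] by blast
    then have "complex_of_real \<mu> \<in># eigenvalues ?A"
      using hyperplane_compression[OF assms(4) w left D] by (metis union_single_eq_member)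
    \<comment> \<open>Any index with value \<open>\<mu>\<close> will do, since only the multiset
      left after removing one such entry matters.\<close>
    then obtain j where j: "ev j = complex_of_real \<mu>"
      unfolding ev by auto
    have remove: "image_mset ev (mset_set UNIV) = add_mset (ev j) (image_mset ev (mset_set (UNIV - {j})))"
      using mset_set.insert_remove[of UNIV j] by (simp add: insert_UNIV)
    have "(\<Sum>i\<in>UNIV. ev i) = trace (complex_mat ?A)"
      using ev by (intro sum_eigenvalues) (simp add: eigenvalues_def)
    also have "\<dots> = complex_of_real (trace ?A)" by (simp add: trace_def complex_mat_def)
    also have "trace ?A = r * \<mu>" using r by (simp add: \<mu>_def)
    finally have sum: "(\<Sum>i\<in>UNIV. ev i) = complex_of_real r * ev j" by (simp add: j)
    have gen: "\<exists>v. generalized_eigenvector (complex_mat ?A) (ev j) (complex_vec v) \<and> transversal_at f p v"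
    proof -
      have "?w \<bullet> (?A *v h - \<mu> *\<^sub>R h) = 0" for h by (simp add: inner_diff_right left)
      then obtain v k where v: "((\<lambda>h. ?A *v h - \<mu> *\<^sub>R h) ^^ k) v = 0" "?w \<bullet> v \<noteq> 0"
        using transversal_generalized_eigenvector[OF linear_matrix_minus_scale w] by metis
      then have "generalized_eigenvector (complex_mat ?A) (ev j) (complex_vec v)"
        unfolding j by (intro generalized_eigenvector_real) auto
      with v show ?thesis by (auto simp: transversal_at_def)
    qed
    have eigvec: "\<exists>v. eigenvector (complex_mat ?A) (ev j) (complex_vec v) \<and> transversal_at f p v"
      if "\<forall>i. i \<noteq> j \<longrightarrow> ev i \<noteq> ev j"
    proof -
      have "ev j \<notin># image_mset ev (mset_set (UNIV - {j}))" using that by auto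
      then have "count (image_mset ev (mset_set (UNIV - {j}))) (ev j) = 0"
        by (simp only: not_in_iff)
      then have "count (eigenvalues ?A) (complex_of_real \<mu>) \<le> 1"
        by (simp add: ev remove flip: j)
      then obtain v where v: "?A *v v = \<mu> *\<^sub>R v" "?w \<bullet> v \<noteq> 0"
        using simple_eigenvalue_transversal[OF assms(4) w left] by blast
      then have "eigenvector (complex_mat ?A) (ev j) (complex_vec v)"
        by (auto simp: eigenvector_def complex_vec_eq_0_iff complex_vec_linear j)
      with v show ?thesis by (auto simp: transversal_at_def)
    qed
    have param: "eigenvalues (jacobian (coordinate_field \<sigma> \<phi>V) (at u)) = image_mset ev (mset_set (UNIV - {j}))"
      if "local_parametrization s \<Gamma> U \<sigma>" "u \<in> U" "\<sigma> u = p" for U :: "(real^'m) set" and \<sigma> u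
      using coordinate_spectrum[OF assms(4) that(1) s2 that(2,3) A X0 inv left]
      by (simp add: ev remove j)
    \<comment> \<open>For a first integral the divergence at \<open>p\<close>, which is the trace,
      is zero, and hence so is \<open>\<mu>\<close>.\<close>
    have "ev j = 0" if "first_integral \<Omega> f \<phi>V"
      using fi[OF that cb p V0] r by (simp add: j \<mu>_def divergence_eq_trace[OF diff\<phi>V[OF p\<Omega>]])
    with sum gen eigvec param show ?thesis by blast
  qed
  show ?thesis
    by (intro conjI ballI allI impI a first_integral_iff[folded \<Gamma>_def] r diff\<phi>V cont_div;
        (elim conjE)?; (rule spectral fi; assumption)?)
qed

end
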